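(* Let $(W,\lambda\colon N\otimes W\to W)$ be an initial algebra of $N\otimes-$ on $\mathsf{SquaMS}$ (so $\lambda$ is an isomorphism), let $V=C(W)$ be its Cauchy completion, and let $\theta\colon N\otimes V\to V$ be the composite of the canonical isometric isomorphism $N\otimes C(W)\cong C(N\otimes W)$ (sending $n\otimes(x_k)_k$ to $(n\otimes x_k)_k$) with $C(\lambda)$. Then $(V,\theta^{-1}\colon V\to N\otimes V)$ is the final $N\otimes-$ coalgebra.
   Context: Let $M_0=\{(r,s)\in[0,1]^2: r\in\{0,1\}\text{ or } s\in\{0,1\}\}$. A square metric space is a pair $(X,S_X)$ with $X$ a metric space with all distances at most $2$ and $S_X\colon M_0\to X$ injective such that (sq1) for $i\in\{0,1\}$, $r,s\in[0,1]$: $d_X(S_X(i,r),S_X(i,s))=|s-r|$ and $d_X(S_X(r,i),S_X(s,i))=|s-r|$; (sq2) $d_X(S_X(r,s),S_X(t,u))\ge|r-t|+|s-u|$. $\mathsf{SquaMS}$: these objects, with short maps $f$ satisfying $f\circ S_X=S_Y$ as morphisms. Let $N=\{0,1,2\}^2$, also viewed as points of $\mathbb{R}^2$. For $X$ in $\mathsf{SquaMS}$, $N\otimes X=(N\times X)/\!\sim$, where $\sim$ is generated by $(m,S_X(p))\sim(n,S_X(q))$ whenever $m,n\in N$ differ by exactly $1$ in exactly one coordinate and $(m+p)/3=(n+q)/3$; $n\otimes x$ is the class of $(n,x)$. With $d((a,u),(b,v))=\frac13 d_X(u,v)$ if $a=b$ and $2$ otherwise, $N\otimes X$ gets the quotient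 metric (infimum over finite chains of sums of consecutive distances, $\sim$-related pairs counting $0$). $S_{N\otimes X}(p)=n\otimes S_X(3p-n)$ for any $n\in N$ with $p\in(n+[0,1]^2)/3$; $(N\otimes f)(n\otimes x)=n\otimes f(x)$. The Cauchy completion $C(X)$ has metric $d((x_i),(y_i))=\lim d_X(x_i,y_i)$ and $S_{C(X)}(p)$ the class of the constant sequence $S_X(p)$. A final coalgebra admits a unique coalgebra morphism from every coalgebra. *)

theory Defs
  imports "HOL-Analysis.Analysis"
begin

text \<open>A square metric space: carrier set, distance function (only relevant on the
carrier) and the injection S of the boundary M0 of the unit square.\<close>

record 'a sqms =
  car :: "'a set"
  dst :: "'a \<Rightarrow> 'a \<Rightarrow> real"
  sqm :: "real \<times> real \<Rightarrow> 'a"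

definition M0 :: "(real \<times> real) set" where
  "M0 = {(r, s). r \<in> {0..1} \<and> s \<in> {0..1} \<and> (r \<in> {0, 1} \<or> s \<in> {0, 1})}"

definition is_metric_on :: "'a set \<Rightarrow> ('a \<Rightarrow> 'a \<Rightarrow> real) \<Rightarrow> bool" where
  "is_metric_on X d \<longleftrightarrow>
     (\<forall>x\<in>X. \<forall>y\<in>X. 0 \<le> d x y \<and> d x y = d y x \<and> (d x y = 0 \<longleftrightarrow> x = y)) \<and>
     (\<forall>x\<in>X. \<forall>y\<in>X. \<forall>z\<in>X. d x z \<le> d x y + d y z)"

definition is_sqms :: "'a sqms \<Rightarrow> bool" where
  "is_sqms X \<longleftrightarrow>
     is_metric_on (car X) (dst X) \<and>
     (\<forall>x\<in>car X. \<forall>y\<in>car X. dst X x y \<le> 2) \<and>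
     sqm X ` M0 \<subseteq> car X \<and> inj_on (sqm X) M0 \<and>
     (\<forall>i\<in>{0::real, 1}. \<forall>r\<in>{0..1}. \<forall>s\<in>{0..1}.
        dst X (sqm X (i, r)) (sqm X (i, s)) = \<bar>s - r\<bar> \<and>
        dst X (sqm X (r, i)) (sqm X (s, i)) = \<bar>s - r\<bar>) \<and>
     (\<forall>r s t u. (r, s) \<in> M0 \<longrightarrow> (t, u) \<in> M0 \<longrightarrow>
        \<bar>r - t\<bar> + \<bar>s - u\<bar> \<le> dst X (sqm X (r, s)) (sqm X (t, u)))"

definition short_sq_map :: "'a sqms \<Rightarrow> 'b sqms \<Rightarrow> ('a \<Rightarrow> 'b) \<Rightarrow> bool" where
  "short_sq_map X Y f \<longleftrightarrow>
     f ` car X \<subseteq> car Y \<and>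
     (\<forall>x\<in>car X. \<forall>y\<in>car X. dst Y (f x) (f y) \<le> dst X x y) \<and>
     (\<forall>p\<in>M0. f (sqm X p) = sqm Y p)"

definition Nset :: "(nat \<times> nat) set" where
  "Nset = {0, 1, 2} \<times> {0, 1, 2}"

definition adjN :: "nat \<times> nat \<Rightarrow> nat \<times> nat \<Rightarrow> bool" where
  "adjN m n \<longleftrightarrow>
     (fst m = fst n \<and> (snd m = snd n + 1 \<or> snd n = snd m + 1)) \<or>
     (snd m = snd n \<and> (fst m = fst n + 1 \<or> fst n = fst m + 1))"

definition tgen :: "'a sqms \<Rightarrow> (((nat \<times> nat) \<times> 'a) \<times> ((nat \<times> nat) \<times> 'a)) set" where
  "tgen X = {((m, sqm X p), (n, sqm X q)) | m n p q.
     m \<in> Nset \<and> n \<in> Nset \<and> adjN m n \<and> p \<in> M0 \<and> q \<in> M0 \<and>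
     real (fst m) + fst p = real (fst n) + fst q \<and>
     real (snd m) + snd p = real (snd n) + snd q}"

definition teq :: "'a sqms \<Rightarrow> (((nat \<times> nat) \<times> 'a) \<times> ((nat \<times> nat) \<times> 'a)) set" where
  "teq X = (tgen X \<union> (tgen X)\<inverse>)\<^sup>*"

definition tcls :: "'a sqms \<Rightarrow> nat \<times> nat \<Rightarrow> 'a \<Rightarrow> ((nat \<times> nat) \<times> 'a) set" where
  "tcls X n x = teq X `` {(n, x)}"

definition tcar :: "'a sqms \<Rightarrow> ((nat \<times> nat) \<times> 'a) set set" where
  "tcar X = (Nset \<times> car X) // teq X"

definition tbase :: "'a sqms \<Rightarrow> (nat \<times> nat) \<times> 'a \<Rightarrow> (nat \<times> nat) \<times> 'a \<Rightarrow> real" where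
  "tbase X a b = (if fst a = fst b then dst X (snd a) (snd b) / 3 else 2)"

definition tstep :: "'a sqms \<Rightarrow> (nat \<times> nat) \<times> 'a \<Rightarrow> (nat \<times> nat) \<times> 'a \<Rightarrow> real" where
  "tstep X a b = (if (a, b) \<in> teq X then 0 else tbase X a b)"

definition tdist :: "'a sqms \<Rightarrow> ((nat \<times> nat) \<times> 'a) set \<Rightarrow> ((nat \<times> nat) \<times> 'a) set \<Rightarrow> real" where
  "tdist X c c' = Inf {sum_list (map2 (tstep X) zs (tl zs)) | zs.
      zs \<noteq> [] \<and> set zs \<subseteq> Nset \<times> car X \<and> hd zs \<in> c \<and> last zs \<in> c'}"

definition tsq :: "'a sqms \<Rightarrow> real \<times> real \<Rightarrow> ((nat \<times> nat) \<times> 'a) set" where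
  "tsq X p = (let n = (SOME n. n \<in> Nset \<and> 3 * fst p - real (fst n) \<in> {0..1}
                                     \<and> 3 * snd p - real (snd n) \<in> {0..1})
              in tcls X n (sqm X (3 * fst p - real (fst n), 3 * snd p - real (snd n))))"

definition tensor :: "'a sqms \<Rightarrow> ((nat \<times> nat) \<times> 'a) set sqms" where
  "tensor X = \<lparr>car = tcar X, dst = tdist X, sqm = tsq X\<rparr>"

definition tmap :: "'b sqms \<Rightarrow> ('a \<Rightarrow> 'b) \<Rightarrow> ((nat \<times> nat) \<times> 'a) set \<Rightarrow> ((nat \<times> nat) \<times> 'b) set" where
  "tmap Y f c = (let z = (SOME z. z \<in> c) in tcls Y (fst z) (f (snd z)))"

definition cauchy_in :: "'a sqms \<Rightarrow> (nat \<Rightarrow> 'a) \<Rightarrow> bool" where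
  "cauchy_in X x \<longleftrightarrow> range x \<subseteq> car X \<and>
     (\<forall>e>0. \<exists>M. \<forall>m n. M \<le> m \<longrightarrow> M \<le> n \<longrightarrow> dst X (x m) (x n) < e)"

definition ceq :: "'a sqms \<Rightarrow> ((nat \<Rightarrow> 'a) \<times> (nat \<Rightarrow> 'a)) set" where
  "ceq X = {(x, y). cauchy_in X x \<and> cauchy_in X y \<and> (\<lambda>i. dst X (x i) (y i)) \<longlonglongrightarrow> 0}"

definition ccar :: "'a sqms \<Rightarrow> (nat \<Rightarrow> 'a) set set" where
  "ccar X = {x. cauchy_in X x} // ceq X"

definition cdist :: "'a sqms \<Rightarrow> (nat \<Rightarrow> 'a) set \<Rightarrow> (nat \<Rightarrow> 'a) set \<Rightarrow> real" where
  "cdist X c c' = lim (\<lambda>i. dst X ((SOME x. x \<in> c) i) ((SOME y. y \<in> c') i))"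

definition csq :: "'a sqms \<Rightarrow> real \<times> real \<Rightarrow> (nat \<Rightarrow> 'a) set" where
  "csq X p = ceq X `` {(\<lambda>i. sqm X p)}"

definition completion :: "'a sqms \<Rightarrow> (nat \<Rightarrow> 'a) set sqms" where
  "completion X = \<lparr>car = ccar X, dst = cdist X, sqm = csq X\<rparr>"

definition cmap :: "'b sqms \<Rightarrow> ('a \<Rightarrow> 'b) \<Rightarrow> (nat \<Rightarrow> 'a) set \<Rightarrow> (nat \<Rightarrow> 'b) set" where
  "cmap Y f c = ceq Y `` {f \<circ> (SOME x. x \<in> c)}"

definition ciso :: "'a sqms \<Rightarrow> ((nat \<times> nat) \<times> (nat \<Rightarrow> 'a) set) set \<Rightarrow> (nat \<Rightarrow> ((nat \<times> nat) \<times> 'a) set) set" where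
  "ciso W c = (let z = (SOME z. z \<in> c); x = (SOME x. x \<in> snd z)
               in ceq (tensor W) `` {(\<lambda>k. tcls W (fst z) (x k))})"

definition theta :: "'a sqms \<Rightarrow> (((nat \<times> nat) \<times> 'a) set \<Rightarrow> 'a)
     \<Rightarrow> ((nat \<times> nat) \<times> (nat \<Rightarrow> 'a) set) set \<Rightarrow> (nat \<Rightarrow> 'a) set" where
  "theta W lam = cmap W lam \<circ> ciso W"

definition is_alg :: "'a sqms \<Rightarrow> (((nat \<times> nat) \<times> 'a) set \<Rightarrow> 'a) \<Rightarrow> bool" where
  "is_alg A alpha \<longleftrightarrow> is_sqms A \<and> short_sq_map (tensor A) A alpha"

definition alg_mor :: "'a sqms \<Rightarrow> (((nat \<times> nat) \<times> 'a) set \<Rightarrow> 'a) \<Rightarrow>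
     'b sqms \<Rightarrow> (((nat \<times> nat) \<times> 'b) set \<Rightarrow> 'b) \<Rightarrow> ('a \<Rightarrow> 'b) \<Rightarrow> bool" where
  "alg_mor A alpha B beta h \<longleftrightarrow> short_sq_map A B h \<and>
     (\<forall>c\<in>car (tensor A). h (alpha c) = beta (tmap B h c))"

definition initial_alg :: "'a sqms \<Rightarrow> (((nat \<times> nat) \<times> 'a) set \<Rightarrow> 'a) \<Rightarrow> bool" where
  "initial_alg W lam \<longleftrightarrow> is_alg W lam \<and>
     (\<forall>(B :: 'a sqms) beta. is_alg B beta \<longrightarrow>
        (\<exists>h. alg_mor W lam B beta h \<and>
             (\<forall>h'. alg_mor W lam B beta h' \<longrightarrow> (\<forall>x\<in>car W. h' x = h x))))"

definition is_coalg :: "'a sqms \<Rightarrow> ('a \<Rightarrow> ((nat \<times> nat) \<times> 'a) set) \<Rightarrow> bool" where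
  "is_coalg Y e \<longleftrightarrow> is_sqms Y \<and> short_sq_map Y (tensor Y) e"

definition coalg_mor :: "'a sqms \<Rightarrow> ('a \<Rightarrow> ((nat \<times> nat) \<times> 'a) set) \<Rightarrow>
     'b sqms \<Rightarrow> ('b \<Rightarrow> ((nat \<times> nat) \<times> 'b) set) \<Rightarrow> ('a \<Rightarrow> 'b) \<Rightarrow> bool" where
  "coalg_mor Y e Z f h \<longleftrightarrow> short_sq_map Y Z h \<and>
     (\<forall>y\<in>car Y. f (h y) = tmap Z h (e y))"

end

theory Submission
  imports Defs
begin

text \<open>The completion \<open>V\<close> is the unit square with the taxicab metric, on which \<open>\<theta>\<close> sends
  \<open>n \<otimes> v\<close> to \<open>(n + v) / 3\<close>.

  In any algebra, opposite boundary points with the same ternary rational height have distance at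
  most 1, since three scaled crossings give a crossing; as every boundary point is close to such
  points, (sq2) is an equality in every algebra. The square is itself an algebra, so \<open>W\<close> maps to it.
  This map is an isometry: if it distorts distances by at most \<open>D\<close>, then so does one more
  application of \<open>N \<otimes> -\<close>, but only by \<open>2 D / 3\<close>, because a shortest path meets the interior of a
  cell at its two ends only and is exact on cell boundaries. Its image is dense.

  For a coalgebra \<open>(Y, e)\<close>, iterating \<open>e\<close> yields ternary digits and thereby a map from \<open>Y\<close> to the
  square, the only candidate for a morphism. It is short by the same \<open>2/3\<close>-contraction of the
  defect, although no short map is available to start an iteration from.\<close>

section \<open>The unit square with the taxicab metric\<close>

abbreviation usq :: "(real \<times> real) set" where
  "usq \<equiv> {0..1} \<times> {0..1}"

definition taxi :: "real \<times> real \<Rightarrow> real \<times> real \<Rightarrow> real" where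
  "taxi p q = \<bar>fst p - fst q\<bar> + \<bar>snd p - snd q\<bar>"

text \<open>The inclusion of the square as cell \<open>n\<close> of the three-by-three subdivision.
  It is the structure map of the square as an algebra, and the gluing condition
  \<open>(m + p) / 3 = (n + q) / 3\<close> reads \<open>place m p = place n q\<close>.\<close>

definition place :: "nat \<times> nat \<Rightarrow> real \<times> real \<Rightarrow> real \<times> real" where
  "place n p = ((real (fst n) + fst p) / 3, (real (snd n) + snd p) / 3)"

lemma in_M0_iff: "(r, s) \<in> M0 \<longleftrightarrow> r \<in> {0..1} \<and> s \<in> {0..1} \<and> (r = 0 \<or> r = 1 \<or> s = 0 \<or> s = 1)"
  by (auto simp: M0_def)

lemma M0_subset_usq: "M0 \<subseteq> usq"
  by (auto simp: M0_def)

lemma in_Nset_iff: "(a, b) \<in> Nset \<longleftrightarrow> a \<le> 2 \<and> b \<le> 2"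
proof -
  have "k \<in> {0, 1, 2} \<longleftrightarrow> k \<le> 2" for k :: nat by auto
  then show ?thesis by (simp only: Nset_def mem_Sigma_iff)
qed

lemma taxi_nonneg [simp]: "0 \<le> taxi p q"
  by (simp add: taxi_def)

lemma taxi_refl [simp]: "taxi p p = 0"
  by (simp add: taxi_def)

lemma taxi_eq_0_iff [simp]: "taxi p q = 0 \<longleftrightarrow> p = q"
  by (auto simp: taxi_def prod_eq_iff)

lemma taxi_commute: "taxi p q = taxi q p"
  by (auto simp: taxi_def)

lemma taxi_triangle: "taxi p r \<le> taxi p q + taxi q r"
  by (auto simp: taxi_def)

lemma taxi_le_2: "p \<in> usq \<Longrightarrow> q \<in> usq \<Longrightarrow> taxi p q \<le> 2"
  by (auto simp: taxi_def)

lemma dist_le_taxi: "dist p q \<le> taxi p q"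
  using sqrt_sum_squares_le_sum_abs[of "dist (fst p) (fst q)" "dist (snd p) (snd q)"]
  by (simp add: dist_prod_def taxi_def dist_real_def)

lemma taxi_place: "taxi (place n p) (place n q) = taxi p q / 3"
proof -
  have *: "\<bar>(a + x) / 3 - (a + y) / 3\<bar> = \<bar>x - y\<bar> / 3" for a x y :: real
    by (simp add: diff_divide_distrib[symmetric])
  show ?thesis
    by (simp add: taxi_def place_def * add_divide_distrib[symmetric] del: diff_divide_distrib)
qed

lemma place_in_usq: "n \<in> Nset \<Longrightarrow> p \<in> usq \<Longrightarrow> place n p \<in> usq"
  by (auto simp: place_def Nset_def)

lemma place_inject: "place n p = place n q \<longleftrightarrow> p = q"
  by (auto simp: place_def prod_eq_iff)

section \<open>Subdivision of the square into nine cells\<close>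

lemma ternary_digit:
  fixes x :: real
  assumes "x \<in> {0..1}"
  obtains a t where "a \<le> (2::nat)" "t \<in> {0..1}" "x = (real a + t) / 3"
proof -
  consider "3 * x \<le> 1" | "1 < 3 * x" "3 * x \<le> 2" | "2 < 3 * x" by linarith
  then show thesis
  proof cases
    case 1 then show thesis using assms by (intro that[of 0 "3 * x"]) auto
  next
    case 2 then show thesis using assms by (intro that[of 1 "3 * x - 1"]) auto
  next
    case 3 then show thesis using assms by (intro that[of 2 "3 * x - 2"]) auto
  qed
qed

lemma usq_place:
  assumes "p \<in> usq"
  obtains n q where "n \<in> Nset" "q \<in> usq" "place n q = p"
proof -
  obtain a s where 1: "a \<le> (2::nat)" "s \<in> {0..1}" "fst p = (real a + s) / 3"
    using assms ternary_digit[of "fst p"] by (auto simp: mem_Times_iff)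
  obtain b t where 2: "b \<le> (2::nat)" "t \<in> {0..1}" "snd p = (real b + t) / 3"
    using assms ternary_digit[of "snd p"] by (auto simp: mem_Times_iff)
  show thesis
    using 1 2 by (intro that[of "(a, b)" "(s, t)"]) (auto simp: place_def in_Nset_iff prod_eq_iff)
qed

text \<open>The outer boundary meets a cell only in sides of the cell. Since \<open>sqm X\<close> is
  meaningful only on \<open>M0\<close>, this keeps arguments there when a boundary point is
  rewritten as a point of a cell.\<close>

lemma place_in_M0_D:
  assumes "n \<in> Nset" "q \<in> usq" "place n q \<in> M0"
  shows "q \<in> M0"
  using assms by (auto simp: place_def Nset_def M0_def field_simps)

text \<open>Closes the contraction arguments: an error that shrinks by a factor 1/3 or 2/3 at each
  level vanishes in the limit.\<close>

lemma le_if_geometric_le: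
  fixes a b c :: real
  assumes "0 \<le> r" "r < 1" and "\<And>k. a \<le> b + c * r ^ k"
  shows "a \<le> b"
proof -
  have "(\<lambda>k. b + c * r ^ k) \<longlonglongrightarrow> b + c * 0"
    using assms by (intro tendsto_intros LIMSEQ_power_zero) auto
  then show ?thesis
    using assms(3) LIMSEQ_le_const by fastforce
qed

text \<open>Subtraction is truncated, so each pair of terms is an absolute difference and the sum
  counts side crossings between two cells. It is the measure for inductions that walk cell by
  cell.\<close>

definition cell_dist :: "nat \<times> nat \<Rightarrow> nat \<times> nat \<Rightarrow> nat" where
  "cell_dist n m = (fst n - fst m) + (fst m - fst n) + (snd n - snd m) + (snd m - snd n)"

text \<open>The witness \<open>p\<close> is the nearest point of cell \<open>n\<close> to the target: clamp each coordinate.\<close>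

lemma gate:
  assumes "n \<in> Nset" "m \<in> Nset" "n \<noteq> m" "u \<in> usq"
  obtains p n' p' where "p \<in> M0" "n' \<in> Nset" "p' \<in> M0" "adjN n n'" "place n p = place n' p'"
    "cell_dist n' m < cell_dist n m"
    "\<And>v. v \<in> usq \<Longrightarrow>
       taxi (place n v) (place m u) = taxi (place n v) (place n p) + taxi (place n p) (place m u)"
proof -
  obtain a b c d x y where nm: "n = (a, b)" "m = (c, d)" "u = (x, y)"
    by (metis surj_pair)
  have N: "a \<le> 2" "b \<le> 2" "c \<le> 2" "d \<le> 2" and u: "0 \<le> x" "x \<le> 1" "0 \<le> y" "y \<le> 1"
    using assms by (auto simp: nm in_Nset_iff)
  define cl where "cl t = max 0 (min 1 t)" for t :: real
  define p where "p = (cl (real c + x - real a), cl (real d + y - real b))"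
  have cl01: "0 \<le> cl t" "cl t \<le> 1" for t
    by (auto simp: cl_def)
  \<comment> \<open>The clamped value lies between \<open>t\<close> and every \<open>s\<close> of
    the unit interval. Since \<open>taxi\<close> adds the coordinates, a point clamped in both lies
    on a geodesic from every point \<open>v\<close> of the cell.\<close>
  have cl_between: "\<bar>s - cl t\<bar> + \<bar>cl t - t\<bar> = \<bar>s - t\<bar>" if "0 \<le> s" "s \<le> 1" for s t
    using that by (auto simp: cl_def max_def min_def)
  have between: "taxi (place n v) (place m u) =
      taxi (place n v) (place n p) + taxi (place n p) (place m u)" if "v \<in> usq" for v
  proof -
    have *: "\<bar>(a + s) / 3 - (c + t) / 3\<bar> = \<bar>s - (c + t - a)\<bar> / 3"
      "\<bar>(a + s) / 3 - (a + t) / 3\<bar> = \<bar>s - t\<bar> / 3" for a c s t :: real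
      by (simp_all add: diff_divide_distrib[symmetric] abs_divide algebra_simps)
    show ?thesis
      using that cl_between[of "fst v" "real c + x - real a"]
        cl_between[of "snd v" "real d + y - real b"]
      by (auto simp: taxi_def place_def nm p_def *)
  qed
  \<comment> \<open>In a coordinate where the cells differ, the target lies at or beyond a side of
    cell \<open>n\<close>, so clamping yields 0 or 1. This puts \<open>p\<close> on the side shared
    with a neighbour \<open>n'\<close> that is closer to \<open>m\<close>.\<close>
  consider "a < c" | "c < a" | "b < d" | "d < b"
    using assms(3) nm by (metis linorder_neqE_nat)
  then show thesis
  proof cases
    case 1
    then have "real a + 1 \<le> real c" by simp
    then have "fst p = 1" using u by (simp add: p_def cl_def)
    then show thesis
      using 1 N cl01 between
      by (intro that[of p "(a + 1, b)" "(0, snd p)"])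
        (auto simp: nm p_def in_M0_iff in_Nset_iff adjN_def place_def cell_dist_def)
  next
    case 2
    then have "real c + 1 \<le> real a" by simp
    then have "fst p = 0" using u by (simp add: p_def cl_def)
    then show thesis
      using 2 N cl01 between
      by (intro that[of p "(a - 1, b)" "(1, snd p)"])
        (auto simp: nm p_def in_M0_iff in_Nset_iff adjN_def place_def cell_dist_def of_nat_diff)
  next
    case 3
    then have "real b + 1 \<le> real d" by simp
    then have "snd p = 1" using u by (simp add: p_def cl_def)
    then show thesis
      using 3 N cl01 between
      by (intro that[of p "(a, b + 1)" "(fst p, 0)"])
        (auto simp: nm p_def in_M0_iff in_Nset_iff adjN_def place_def cell_dist_def)
  next
    case 4
    then have "real d + 1 \<le> real b" by simp
    then have "snd p = 0" using u by (simp add: p_def cl_def)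
    then show thesis
      using 4 N cl01 between
      by (intro that[of p "(a, b - 1)" "(fst p, 1)"])
        (auto simp: nm p_def in_M0_iff in_Nset_iff adjN_def place_def cell_dist_def of_nat_diff)
  qed
qed

section \<open>Square metric spaces and the gluing relation\<close>

lemma is_sqmsD:
  assumes "is_sqms X"
  shows sqms_nonneg: "x \<in> car X \<Longrightarrow> y \<in> car X \<Longrightarrow> 0 \<le> dst X x y"
    and sqms_commute: "x \<in> car X \<Longrightarrow> y \<in> car X \<Longrightarrow> dst X x y = dst X y x"
    and sqms_eq_0_iff: "x \<in> car X \<Longrightarrow> y \<in> car X \<Longrightarrow> dst X x y = 0 \<longleftrightarrow> x = y"
    and sqms_triangle: "x \<in> car X \<Longrightarrow> y \<in> car X \<Longrightarrow> z \<in> car X \<Longrightarrow> dst X x z \<le> dst X x y + dst X y z"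
    and sqms_le_2: "x \<in> car X \<Longrightarrow> y \<in> car X \<Longrightarrow> dst X x y \<le> 2"
    and sqms_sqm_in: "p \<in> M0 \<Longrightarrow> sqm X p \<in> car X"
    and sqms_inj: "inj_on (sqm X) M0"
    and sqms_side1: "i = 0 \<or> i = 1 \<Longrightarrow> r \<in> {0..1} \<Longrightarrow> s \<in> {0..1} \<Longrightarrow>
      dst X (sqm X (i, r)) (sqm X (i, s)) = \<bar>s - r\<bar>"
    and sqms_side2: "i = 0 \<or> i = 1 \<Longrightarrow> r \<in> {0..1} \<Longrightarrow> s \<in> {0..1} \<Longrightarrow>
      dst X (sqm X (r, i)) (sqm X (s, i)) = \<bar>s - r\<bar>"
    and sqms_taxi_le: "p \<in> M0 \<Longrightarrow> q \<in> M0 \<Longrightarrow> taxi p q \<le> dst X (sqm X p) (sqm X q)"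
proof -
  note sq = assms[unfolded is_sqms_def is_metric_on_def]
  show "x \<in> car X \<Longrightarrow> y \<in> car X \<Longrightarrow> 0 \<le> dst X x y"
    and "x \<in> car X \<Longrightarrow> y \<in> car X \<Longrightarrow> dst X x y = dst X y x"
    and "x \<in> car X \<Longrightarrow> y \<in> car X \<Longrightarrow> dst X x y = 0 \<longleftrightarrow> x = y"
    using sq[THEN conjunct1, THEN conjunct1] by blast+
  show "x \<in> car X \<Longrightarrow> y \<in> car X \<Longrightarrow> z \<in> car X \<Longrightarrow> dst X x z \<le> dst X x y + dst X y z"
    using sq[THEN conjunct1, THEN conjunct2] by blast
  show "x \<in> car X \<Longrightarrow> y \<in> car X \<Longrightarrow> dst X x y \<le> 2"
    and "p \<in> M0 \<Longrightarrow> sqm X p \<in> car X" and "inj_on (sqm X) M0"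
    using sq by auto
  show "i = 0 \<or> i = 1 \<Longrightarrow> r \<in> {0..1} \<Longrightarrow> s \<in> {0..1} \<Longrightarrow>
      dst X (sqm X (i, r)) (sqm X (i, s)) = \<bar>s - r\<bar>"
    and "i = 0 \<or> i = 1 \<Longrightarrow> r \<in> {0..1} \<Longrightarrow> s \<in> {0..1} \<Longrightarrow>
      dst X (sqm X (r, i)) (sqm X (s, i)) = \<bar>s - r\<bar>"
    using sq by auto
  show "p \<in> M0 \<Longrightarrow> q \<in> M0 \<Longrightarrow> taxi p q \<le> dst X (sqm X p) (sqm X q)"
    using sq by (cases p; cases q) (simp add: taxi_def)
qed

section \<open>The gluing relation and its classes\<close>

lemma teq_refl [simp]: "(a, a) \<in> teq X"
  by (simp add: teq_def)

lemma teq_sym: "(a, b) \<in> teq X \<Longrightarrow> (b, a) \<in> teq X"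
  unfolding teq_def by (rule symD[OF sym_rtrancl]) (auto simp: sym_def)

lemma teq_trans: "(a, b) \<in> teq X \<Longrightarrow> (b, c) \<in> teq X \<Longrightarrow> (a, c) \<in> teq X"
  unfolding teq_def by (rule rtrancl_trans)

lemma equiv_teq: "equiv UNIV (teq X)"
  by (intro equivI) (auto simp: refl_on_def sym_def trans_def intro: teq_sym teq_trans)

lemma tcls_eq_iff: "tcls X n x = tcls X m y \<longleftrightarrow> ((n, x), (m, y)) \<in> teq X"
  unfolding tcls_def by (rule eq_equiv_class_iff[OF equiv_teq]) auto

lemma in_tcls_iff: "z \<in> tcls X n x \<longleftrightarrow> ((n, x), z) \<in> teq X"
  by (auto simp: tcls_def)

lemma self_in_tcls [simp]: "(n, x) \<in> tcls X n x"
  by (simp add: in_tcls_iff)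

lemma tgen_in_teq:
  assumes "m \<in> Nset" "n \<in> Nset" "adjN m n" "p \<in> M0" "q \<in> M0" "place m p = place n q"
  shows "((m, sqm X p), (n, sqm X q)) \<in> teq X"
proof -
  have "((m, sqm X p), (n, sqm X q)) \<in> tgen X"
    unfolding tgen_def mem_Collect_eq using assms
    by (intro exI[of _ m] exI[of _ n] exI[of _ p] exI[of _ q]) (auto simp: place_def)
  then show ?thesis by (auto simp: teq_def)
qed

text \<open>Adjacency and the direction of a generator are forgotten: equality of places is
  symmetric, so one case covers a generating pair and its converse.\<close>

lemma teq_induct [consumes 1, case_names refl glue]:
  assumes "(a, b) \<in> teq X"
    and "P a"
    and "\<And>m n p q. P (m, sqm X p) \<Longrightarrow> m \<in> Nset \<Longrightarrow> n \<in> Nset \<Longrightarrow> p \<in> M0 \<Longrightarrow> q \<in> M0 \<Longrightarrow>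
           place m p = place n q \<Longrightarrow> P (n, sqm X q)"
  shows "P b"
  using assms(1) unfolding teq_def
proof (induction rule: rtrancl_induct)
  case base
  then show ?case by (rule assms(2))
next
  case (step y z)
  then obtain m n p q where "y = (m, sqm X p)" "z = (n, sqm X q)" "m \<in> Nset" "n \<in> Nset"
    "p \<in> M0" "q \<in> M0" "place m p = place n q"
    unfolding tgen_def place_def by fastforce
  then show ?case using assms(3) step.IH by blast
qed

lemma teq_closed:
  assumes "(a, b) \<in> teq X" "a \<in> Nset \<times> car X" "sqm X ` M0 \<subseteq> car X"
  shows "b \<in> Nset \<times> car X"
  using assms by (induction rule: teq_induct) auto

text \<open>Both members of a generating pair are boundary points, so a nontrivial chain of gluings
  starts and ends in the image of \<open>sqm X\<close>. The induction is run once from each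
  end.\<close>

lemma teq_cases:
  assumes "(a, b) \<in> teq X"
  obtains "a = b" | p q where "p \<in> M0" "q \<in> M0" "snd a = sqm X p" "snd b = sqm X q"
proof -
  have "a = b \<or> (\<exists>q\<in>M0. snd b = sqm X q)"
    using assms by (induction rule: teq_induct) auto
  moreover have "b = a \<or> (\<exists>q\<in>M0. snd a = sqm X q)"
    using assms[THEN teq_sym] by (induction rule: teq_induct) auto
  ultimately show thesis using that by blast
qed

text \<open>The position in the square is invariant under gluing, for every \<open>h\<close> that
  undoes \<open>sqm X\<close> on the boundary. This makes constructions through a chosen
  representative well defined.\<close>

lemma teq_place:
  assumes "(a, b) \<in> teq X" and "\<And>p. p \<in> M0 \<Longrightarrow> h (sqm X p) = p"
  shows "place (fst a) (h (snd a)) = place (fst b) (h (snd b))"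
  using assms(1) by (induction rule: teq_induct) (auto simp: assms(2))

text \<open>A partial converse of \<open>teq_place\<close>. Only cells sharing a side are glued
  directly, so cells meeting in a corner need intermediate ones. The gate towards \<open>m\<close>
  lies on a geodesic of length 0, hence is the point itself, and the walk passes to the neighbour
  and recurses.\<close>

lemma place_eq_imp_teq:
  assumes N: "n \<in> Nset" "m \<in> Nset" and "p \<in> usq" "q \<in> usq" and eq: "place n p = place m q"
    and "n \<noteq> m"
  shows "p \<in> M0" "q \<in> M0" "((n, sqm X p), (m, sqm X q)) \<in> teq X"
proof -
  have boundary: "p \<in> M0 \<and> q \<in> M0 \<and> ((n, sqm X p), (m, sqm X q)) \<in> teq X"
    if "n \<in> Nset" "m \<in> Nset" "p \<in> usq" "q \<in> usq" "place n p = place m q" "n \<noteq> m"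
    for n m p q
    using that
  proof (induction "cell_dist n m" arbitrary: n p rule: less_induct)
    case less
    obtain r n' r' where r: "r \<in> M0" "n' \<in> Nset" "r' \<in> M0" "adjN n n'" "place n r = place n' r'"
      "cell_dist n' m < cell_dist n m"
      and g: "\<And>v. v \<in> usq \<Longrightarrow>
        taxi (place n v) (place m q) = taxi (place n v) (place n r) + taxi (place n r) (place m q)"
      using gate[of n m q] less.prems by metis
    have "taxi (place n p) (place m q) = 0"
      using less.prems(5) by simp
    then have "taxi (place n p) (place n r) = 0"
      using g[OF less.prems(3)] taxi_nonneg[of "place n p" "place n r"]
        taxi_nonneg[of "place n r" "place m q"] by linarith
    then have pr: "p = r" by (simp add: place_inject)
    have t: "((n, sqm X p), (n', sqm X r')) \<in> teq X"
      using tgen_in_teq r less.prems pr by metis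
    show ?case
    proof (cases "n' = m")
      case True
      then have "r' = q" using r less.prems pr place_inject by metis
      then show ?thesis using True t r pr by auto
    next
      case False
      then have "q \<in> M0 \<and> ((n', sqm X r'), (m, sqm X q)) \<in> teq X"
        using less.hyps[of n' r'] r less.prems pr M0_subset_usq by auto
      then show ?thesis using t teq_trans r pr by blast
    qed
  qed
  show "p \<in> M0" "q \<in> M0" "((n, sqm X p), (m, sqm X q)) \<in> teq X"
    using boundary[of n m p q] assms by auto
qed

text \<open>The cell picked by \<open>SOME\<close> in \<open>tsq\<close> is immaterial: all cells
  containing the point hold glued copies of it.\<close>

lemma tsq_place:
  assumes "n \<in> Nset" "q \<in> usq" "place n q \<in> M0"
  shows "tsq X (place n q) = tcls X n (sqm X q)"
proof -
  let ?p = "place n q"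
  let ?P = "\<lambda>n. n \<in> Nset \<and> 3 * fst ?p - real (fst n) \<in> {0..1} \<and> 3 * snd ?p - real (snd n) \<in> {0..1}"
  define m where "m = (SOME n. ?P n)"
  define r where "r = (3 * fst ?p - real (fst m), 3 * snd ?p - real (snd m))"
  have "?P n" using assms by (auto simp: place_def add_divide_distrib)
  then have m: "?P m" unfolding m_def by (rule someI)
  have r: "r \<in> usq" "place m r = ?p"
    using m by (auto simp: r_def place_def)
  have "tsq X ?p = tcls X m (sqm X r)"
    by (simp add: tsq_def m_def r_def Let_def)
  also have "\<dots> = tcls X n (sqm X q)"
  proof (cases "m = n")
    case True
    then show ?thesis using r place_inject by metis
  next
    case False
    then show ?thesis
      unfolding tcls_eq_iff using place_eq_imp_teq(3)[of m n r q X] m r assms by auto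
  qed
  finally show ?thesis .
qed

lemma tcls_in_tcar: "n \<in> Nset \<Longrightarrow> x \<in> car X \<Longrightarrow> tcls X n x \<in> tcar X"
  by (auto simp: tcar_def tcls_def intro: quotientI)

lemma tcarE:
  assumes "c \<in> tcar X"
  obtains n x where "n \<in> Nset" "x \<in> car X" "c = tcls X n x"
  using assms by (auto simp: tcar_def tcls_def elim!: quotientE)

lemma tcar_memD:
  assumes "c \<in> tcar X" "z \<in> c" "sqm X ` M0 \<subseteq> car X"
  shows "fst z \<in> Nset" "snd z \<in> car X" "c = tcls X (fst z) (snd z)"
proof -
  obtain n x where nx: "n \<in> Nset" "x \<in> car X" "c = tcls X n x"
    using assms(1) by (rule tcarE)
  have t: "((n, x), z) \<in> teq X" using assms nx in_tcls_iff by metis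
  show "fst z \<in> Nset" "snd z \<in> car X"
    using teq_closed[OF t] assms nx by (auto simp: mem_Times_iff)
  show "c = tcls X (fst z) (snd z)"
    using t nx by (simp add: tcls_eq_iff)
qed

lemma tcar_some_in: "c \<in> tcar X \<Longrightarrow> (SOME z. z \<in> c) \<in> c"
  by (metis self_in_tcls someI tcarE)

section \<open>The quotient metric\<close>

abbreviation cost :: "'a sqms \<Rightarrow> ((nat \<times> nat) \<times> 'a) list \<Rightarrow> real" where
  "cost X zs \<equiv> sum_list (map2 (tstep X) zs (tl zs))"

text \<open>Upper bounds for the quotient distance are assembled from explicit chains, which can be
  concatenated with their costs adding up.\<close>

definition reach :: "'a sqms \<Rightarrow> (nat \<times> nat) \<times> 'a \<Rightarrow> (nat \<times> nat) \<times> 'a \<Rightarrow> real \<Rightarrow> bool" where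
  "reach X a b r \<longleftrightarrow>
     (\<exists>zs. zs \<noteq> [] \<and> set zs \<subseteq> Nset \<times> car X \<and> hd zs = a \<and> last zs = b \<and> cost X zs \<le> r)"

lemma cost_append:
  assumes "zs \<noteq> []" "ws \<noteq> []" "last zs = hd ws"
  shows "cost X (zs @ tl ws) = cost X zs + cost X ws"
  using assms
proof (induction zs rule: induct_list012)
  case (2 z)
  then show ?case by (cases ws) auto
next
  case (3 x y zs)
  then show ?case by simp
qed simp

lemma cost_snoc: "zs \<noteq> [] \<Longrightarrow> cost X (zs @ [z]) = cost X zs + tstep X (last zs) z"
  using cost_append[of zs "[last zs, z]" X] by simp

lemma reach_step:
  assumes "a \<in> Nset \<times> car X" "b \<in> Nset \<times> car X" "tstep X a b \<le> r"
  shows "reach X a b r"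
  unfolding reach_def using assms by (intro exI[of _ "[a, b]"]) auto

lemma reach_teq:
  assumes "a \<in> Nset \<times> car X" "b \<in> Nset \<times> car X" "(a, b) \<in> teq X"
  shows "reach X a b 0"
  using assms by (intro reach_step) (auto simp: tstep_def)

lemma reach_cell:
  assumes "is_sqms X" "n \<in> Nset" "x \<in> car X" "y \<in> car X" "dst X x y / 3 \<le> r"
  shows "reach X (n, x) (n, y) r"
  using assms sqms_nonneg[of X x y] by (intro reach_step) (auto simp: tstep_def tbase_def)

lemma reach_trans:
  assumes "reach X a b r" "reach X b c s"
  shows "reach X a c (r + s)"
proof -
  obtain zs where zs: "zs \<noteq> []" "set zs \<subseteq> Nset \<times> car X" "hd zs = a" "last zs = b" "cost X zs \<le> r"
    using assms(1) unfolding reach_def by blast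
  obtain ws where ws: "ws \<noteq> []" "set ws \<subseteq> Nset \<times> car X" "hd ws = b" "last ws = c" "cost X ws \<le> s"
    using assms(2) unfolding reach_def by blast
  have "last (zs @ tl ws) = c"
    using zs ws by (cases ws) (auto split: if_splits)
  moreover have "set (zs @ tl ws) \<subseteq> Nset \<times> car X"
    using zs ws by (cases ws) auto
  moreover have "cost X (zs @ tl ws) \<le> r + s"
    using cost_append[of zs ws X] zs ws by simp
  ultimately show ?thesis
    unfolding reach_def using zs by (intro exI[of _ "zs @ tl ws"]) auto
qed

lemma tstep_nonneg:
  assumes "is_sqms X" "a \<in> Nset \<times> car X" "b \<in> Nset \<times> car X"
  shows "0 \<le> tstep X a b"
  using assms sqms_nonneg[OF assms(1)] by (auto simp: tstep_def tbase_def)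

lemma cost_nonneg:
  assumes "is_sqms X" "set zs \<subseteq> Nset \<times> car X"
  shows "0 \<le> cost X zs"
  using assms(2)
proof (induction zs rule: induct_list012)
  case (3 x y zs)
  then show ?case using tstep_nonneg[OF assms(1), of x y] by simp
qed simp_all

section \<open>Bounds on the quotient distance\<close>

lemma tdist_le:
  assumes "is_sqms X" "reach X a b r" "a \<in> c" "b \<in> c'"
  shows "tdist X c c' \<le> r"
proof -
  obtain zs where zs: "zs \<noteq> []" "set zs \<subseteq> Nset \<times> car X" "hd zs = a" "last zs = b" "cost X zs \<le> r"
    using assms(2) unfolding reach_def by blast
  have "tdist X c c' \<le> cost X zs"
    unfolding tdist_def using zs assms
    by (intro cInf_lower bdd_belowI[of _ 0]) (auto intro!: cost_nonneg)
  then show ?thesis using zs by simp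
qed

lemma tdist_ge:
  assumes "c \<in> tcar X" "c' \<in> tcar X"
    and "\<And>zs. zs \<noteq> [] \<Longrightarrow> set zs \<subseteq> Nset \<times> car X \<Longrightarrow> hd zs \<in> c \<Longrightarrow> last zs \<in> c' \<Longrightarrow> r \<le> cost X zs"
  shows "r \<le> tdist X c c'"
proof -
  obtain n x m y where "n \<in> Nset" "x \<in> car X" "c = tcls X n x" "m \<in> Nset" "y \<in> car X" "c' = tcls X m y"
    using assms by (metis tcarE)
  \<comment> \<open>A two-point chain shows that the infimum is not taken over the empty
    set.\<close>
  then have "[(n, x), (m, y)] \<noteq> [] \<and> set [(n, x), (m, y)] \<subseteq> Nset \<times> car X \<and>
      hd [(n, x), (m, y)] \<in> c \<and> last [(n, x), (m, y)] \<in> c'"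
    by auto
  then show ?thesis
    unfolding tdist_def using assms(3) by (intro cInf_greatest) blast+
qed

text \<open>A chain can be shortened so that it meets the interior of a cell only in its first and its last
  cell; on boundary points the map is short by (sq2), so the error occurs at most twice, each time
  scaled by 1/3.\<close>

lemma cost_lower_bound:
  assumes X: "is_sqms X" and h: "h ` car X \<subseteq> usq" and hS: "\<And>p. p \<in> M0 \<Longrightarrow> h (sqm X p) = p"
    and eps: "0 \<le> \<epsilon>" "\<And>x y. x \<in> car X \<Longrightarrow> y \<in> car X \<Longrightarrow> taxi (h x) (h y) \<le> dst X x y + \<epsilon>"
    and zs: "zs \<noteq> []" "set zs \<subseteq> Nset \<times> car X"
  shows "taxi (place (fst (hd zs)) (h (snd (hd zs)))) (place (fst (last zs)) (h (snd (last zs))))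
           \<le> cost X zs + 2 * \<epsilon> / 3"
proof -
  define G where "G z = place (fst z) (h (snd z))" for z
  have Gcell: "taxi (G (n, x)) (G (n, y)) \<le> dst X x y / 3 + \<epsilon> / 3" if "x \<in> car X" "y \<in> car X" for n x y
    using eps(2)[OF that] by (simp add: G_def taxi_place)
  have Gbd: "taxi (G (n, sqm X p)) (G (n, sqm X q)) \<le> dst X (sqm X p) (sqm X q) / 3"
    if "p \<in> M0" "q \<in> M0" for n p q
    using sqms_taxi_le[OF X that] that by (simp add: G_def taxi_place hS)
  have G2: "taxi (G a) (G b) \<le> 2" if "a \<in> Nset \<times> car X" "b \<in> Nset \<times> car X" for a b
    using that h by (intro taxi_le_2) (auto simp: G_def intro!: place_in_usq)
  \<comment> \<open>Invariant of a chain from \<open>a\<close> to \<open>b\<close>. Its cost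
    \<open>r\<close> dominates a direct step inside the first cell; or a path to a boundary point of
    the current cell followed by a direct step there, up to one error \<open>\<epsilon> / 3\<close>;
    or 2, the diameter of the square.\<close>
  define I where "I a b r \<longleftrightarrow> (fst b = fst a \<and> dst X (snd a) (snd b) / 3 \<le> r) \<or>
    (\<exists>p\<in>M0. taxi (G a) (G (fst b, sqm X p)) + dst X (sqm X p) (snd b) / 3 \<le> r + \<epsilon> / 3) \<or> 2 \<le> r"
    for a b r
  have "I (hd zs) (last zs) (cost X zs)"
    using zs
  proof (induction zs rule: rev_nonempty_induct)
    case (single z)
    then show ?case
      using sqms_eq_0_iff[OF X, of "snd z" "snd z"] by (auto simp: I_def)
  next
    case (snoc z zs)
    obtain n x where z: "z = (n, x)" "x \<in> car X" "n \<in> Nset" using snoc.prems by auto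
    obtain m y where l: "last zs = (m, y)" "y \<in> car X" "m \<in> Nset"
      using snoc.prems last_in_set[OF snoc.hyps(1)] by (cases "last zs") auto
    obtain k w where a: "hd zs = (k, w)" "w \<in> car X" "k \<in> Nset"
      using snoc.prems hd_in_set[OF snoc.hyps(1)] by (cases "hd zs") auto
    let ?r = "cost X zs" and ?s = "tstep X (m, y) (n, x)"
    have IH: "I (k, w) (m, y) ?r"
      using snoc a l by auto
    have "I (k, w) (n, x) (?r + ?s)"
    proof (cases "((m, y), (n, x)) \<in> teq X")
      case True
      then have s: "?s = 0" by (simp add: tstep_def)
      show ?thesis
        using True
      proof (cases rule: teq_cases)
        case 1
        then show ?thesis using IH s by auto
      next
        case (2 p q)
        then have pq: "y = sqm X p" "x = sqm X q" "p \<in> M0" "q \<in> M0" by auto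
        have Geq: "G (n, x) = G (m, y)"
          using teq_place[OF True hS] by (simp add: G_def)
        have x0: "dst X x x = 0" using sqms_eq_0_iff[OF X] z by simp
        \<comment> \<open>Leaving a cell: the leg from the entry \<open>p'\<close> to the exit
          \<open>p\<close> joins boundary points, so (sq2) bounds it without error. Only a stay in
          the first cell, which may begin in the interior, is charged
          \<open>\<epsilon> / 3\<close>.\<close>
        have "taxi (G (k, w)) (G (m, y)) \<le> ?r + \<epsilon> / 3 \<or> 2 \<le> ?r"
          using IH unfolding I_def
        proof (elim disjE bexE)
          fix p' assume "p' \<in> M0" "taxi (G (k, w)) (G (fst (m, y), sqm X p')) +
            dst X (sqm X p') (snd (m, y)) / 3 \<le> ?r + \<epsilon> / 3"
          then show ?thesis
            using Gbd[of p' p m] taxi_triangle[of "G (k, w)" "G (m, y)" "G (m, sqm X p')"] pq by auto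
        next
          assume "fst (m, y) = fst (k, w) \<and> dst X (snd (k, w)) (snd (m, y)) / 3 \<le> ?r"
          then show ?thesis
            using Gcell[of w y k] a l by auto
        qed simp
        then show ?thesis
          unfolding I_def s using pq Geq x0 by (auto intro!: bexI[of _ q])
      qed
    next
      case False
      show ?thesis
      proof (cases "n = m")
        case True
        then have s: "?s = dst X y x / 3" using False by (simp add: tstep_def tbase_def)
        have tri: "dst X u x \<le> dst X u y + dst X y x" if "u \<in> car X" for u
          using sqms_triangle[OF X that] z l by simp
        from IH show ?thesis
          unfolding I_def
        proof (elim disjE bexE)
          fix p' assume p': "p' \<in> M0" "taxi (G (k, w)) (G (fst (m, y), sqm X p')) +
            dst X (sqm X p') (snd (m, y)) / 3 \<le> ?r + \<epsilon> / 3"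
          then have "taxi (G (k, w)) (G (fst (n, x), sqm X p')) +
            dst X (sqm X p') (snd (n, x)) / 3 \<le> ?r + ?s + \<epsilon> / 3"
            using tri[OF sqms_sqm_in[OF X p'(1)]] True s by simp
          then show "(fst (n, x) = fst (k, w) \<and> dst X (snd (k, w)) (snd (n, x)) / 3 \<le> ?r + ?s) \<or>
            (\<exists>p\<in>M0. taxi (G (k, w)) (G (fst (n, x), sqm X p)) + dst X (sqm X p) (snd (n, x)) / 3
              \<le> ?r + ?s + \<epsilon> / 3) \<or> 2 \<le> ?r + ?s"
            using p'(1) by blast
        next
          assume "2 \<le> ?r"
          moreover have "0 \<le> ?s" using tstep_nonneg[OF X] z l by simp
          ultimately show "(fst (n, x) = fst (k, w) \<and> dst X (snd (k, w)) (snd (n, x)) / 3 \<le> ?r + ?s) \<or>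
            (\<exists>p\<in>M0. taxi (G (k, w)) (G (fst (n, x), sqm X p)) + dst X (sqm X p) (snd (n, x)) / 3
              \<le> ?r + ?s + \<epsilon> / 3) \<or> 2 \<le> ?r + ?s" by simp
        qed (use tri[of w] True s a in auto)
      next
        case False2: False
        \<comment> \<open>Changing cells without gluing costs 2, so the third alternative holds from
          here on.\<close>
        then have "?s = 2" using False by (simp add: tstep_def tbase_def)
        moreover have "0 \<le> ?r" using cost_nonneg[OF X, of zs] snoc.prems by simp
        ultimately show ?thesis by (simp add: I_def)
      qed
    qed
    then show ?case
      using snoc.hyps a l z by (simp add: cost_snoc del: tl_append2)
  qed
  moreover obtain m y where l: "last zs = (m, y)" "y \<in> car X" "m \<in> Nset"
    using zs last_in_set[OF zs(1)] by (cases "last zs") auto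
  moreover obtain k w where a: "hd zs = (k, w)" "w \<in> car X" "k \<in> Nset"
    using zs hd_in_set[OF zs(1)] by (cases "hd zs") auto
  ultimately have I: "I (k, w) (m, y) (cost X zs)" by simp
  \<comment> \<open>The last leg may end in the interior of its cell, which brings the second
    \<open>\<epsilon> / 3\<close>.\<close>
  then have "taxi (G (k, w)) (G (m, y)) \<le> cost X zs + 2 * \<epsilon> / 3"
    unfolding I_def
  proof (elim disjE bexE)
    fix p assume "p \<in> M0" "taxi (G (k, w)) (G (fst (m, y), sqm X p)) +
      dst X (sqm X p) (snd (m, y)) / 3 \<le> cost X zs + \<epsilon> / 3"
    then show ?thesis
      using Gcell[of "sqm X p" y m] sqms_sqm_in[OF X, of p] l
        taxi_triangle[of "G (k, w)" "G (m, y)" "G (m, sqm X p)"] by simp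
  next
    assume "2 \<le> cost X zs"
    then show ?thesis using G2[of "(k, w)" "(m, y)"] a l eps by simp
  next
    assume "fst (m, y) = fst (k, w) \<and> dst X (snd (k, w)) (snd (m, y)) / 3 \<le> cost X zs"
    then show ?thesis
      using Gcell[of w y k] a l eps by auto
  qed
  then show ?thesis by (simp add: G_def a l)
qed

text \<open>With \<open>\<epsilon> = 0\<close> a short map into the square induces a short map on
  \<open>N \<otimes> X\<close>; with \<open>\<epsilon> > 0\<close> this is the factor 2/3 in the
  contraction for coalgebras.\<close>

lemma tdist_lower_bound:
  assumes X: "is_sqms X" and h: "h ` car X \<subseteq> usq" and hS: "\<And>p. p \<in> M0 \<Longrightarrow> h (sqm X p) = p"
    and eps: "0 \<le> \<epsilon>" "\<And>x y. x \<in> car X \<Longrightarrow> y \<in> car X \<Longrightarrow> taxi (h x) (h y) \<le> dst X x y + \<epsilon>"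
    and c: "c \<in> tcar X" "c' \<in> tcar X" "z \<in> c" "z' \<in> c'"
  shows "taxi (place (fst z) (h (snd z))) (place (fst z') (h (snd z'))) \<le> tdist X c c' + 2 * \<epsilon> / 3"
proof -
  have S: "sqm X ` M0 \<subseteq> car X" using sqms_sqm_in[OF X] by auto
  have "taxi (place (fst z) (h (snd z))) (place (fst z') (h (snd z'))) - 2 * \<epsilon> / 3 \<le> tdist X c c'"
  proof (rule tdist_ge[OF c(1,2)])
    fix zs assume zs: "zs \<noteq> []" "set zs \<subseteq> Nset \<times> car X" "hd zs \<in> c" "last zs \<in> c'"
    have inv: "place (fst u) (h (snd u)) = place (fst v) (h (snd v))"
      if "d \<in> tcar X" "u \<in> d" "v \<in> d" for d u v
    proof -
      have "(u, v) \<in> teq X"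
        using tcar_memD(3)[OF that(1) _ S] that by (metis in_tcls_iff prod.collapse)
      then show ?thesis using hS by (rule teq_place)
    qed
    show "taxi (place (fst z) (h (snd z))) (place (fst z') (h (snd z'))) - 2 * \<epsilon> / 3 \<le> cost X zs"
      using cost_lower_bound[OF X h hS eps zs(1,2)] inv[OF c(1) c(3) zs(3)] inv[OF c(2) c(4) zs(4)]
      by simp
  qed
  then show ?thesis by simp
qed

text \<open>Walk from gate to gate: the gates lie on a taxicab geodesic, passing a gate is free, and
  every leg inside a cell joins two boundary points, where \<open>bd\<close> applies.\<close>

lemma reach_boundary:
  assumes X: "is_sqms X"
    and bd: "\<And>p q. p \<in> M0 \<Longrightarrow> q \<in> M0 \<Longrightarrow> dst X (sqm X p) (sqm X q) \<le> taxi p q"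
    and "n \<in> Nset" "m \<in> Nset" "p \<in> M0" "q \<in> M0"
  shows "reach X (n, sqm X p) (m, sqm X q) (taxi (place n p) (place m q))"
  using assms(3-)
proof (induction "cell_dist n m" arbitrary: n p rule: less_induct)
  case less
  note in_car = sqms_sqm_in[OF X]
  show ?case
  proof (cases "n = m")
    case True
    then show ?thesis
      unfolding True using less.prems bd[of p q] in_car
      by (intro reach_cell X) (auto simp: taxi_place)
  next
    case False
    obtain r n' r' where r: "r \<in> M0" "n' \<in> Nset" "r' \<in> M0" "adjN n n'" "place n r = place n' r'"
      "cell_dist n' m < cell_dist n m"
      and "\<And>v. v \<in> usq \<Longrightarrow>
        taxi (place n v) (place m q) = taxi (place n v) (place n r) + taxi (place n r) (place m q)"
      using gate[of n m q] less.prems False M0_subset_usq by blast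
    then have g: "taxi (place n p) (place m q) =
        taxi (place n p) (place n r) + taxi (place n r) (place m q)"
      using less.prems M0_subset_usq by blast
    have "reach X (n, sqm X p) (n, sqm X r) (taxi (place n p) (place n r))"
      using less.prems bd[of p r] in_car r(1) by (intro reach_cell X) (auto simp: taxi_place)
    then have "reach X (n, sqm X p) (n', sqm X r') (taxi (place n p) (place n r) + 0)"
      using less.prems in_car[of r] in_car[of r'] r by (elim reach_trans) (auto intro!: reach_teq tgen_in_teq)
    moreover have "reach X (n', sqm X r') (m, sqm X q) (taxi (place n' r') (place m q))"
      using less r by blast
    ultimately show ?thesis
      using reach_trans r(5) g by (metis add.right_neutral)
  qed
qed

text \<open>Between different cells, both ends are joined to gates, and the walk between the gates
  is exact by \<open>reach_boundary\<close>. Only the two end legs suffer the distortion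
  \<open>D\<close>, each scaled by 1/3.\<close>

lemma reach_upper_bound:
  assumes X: "is_sqms X"
    and bd: "\<And>p q. p \<in> M0 \<Longrightarrow> q \<in> M0 \<Longrightarrow> dst X (sqm X p) (sqm X q) \<le> taxi p q"
    and f: "f ` car X \<subseteq> usq" and fS: "\<And>p. p \<in> M0 \<Longrightarrow> f (sqm X p) = p"
    and D: "0 \<le> D" "\<And>x y. x \<in> car X \<Longrightarrow> y \<in> car X \<Longrightarrow> dst X x y \<le> taxi (f x) (f y) + D"
    and nm: "n \<in> Nset" "m \<in> Nset" "x \<in> car X" "y \<in> car X"
  shows "reach X (n, x) (m, y) (taxi (place n (f x)) (place m (f y)) + 2 * D / 3)"
proof (cases "n = m")
  case True
  then show ?thesis
    unfolding True using nm D(1) D(2)[of x y] by (intro reach_cell X) (auto simp: taxi_place)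
next
  case False
  note in_car = sqms_sqm_in[OF X]
  have fx: "f x \<in> usq" "f y \<in> usq" using f nm by auto
  obtain p where p: "p \<in> M0" and gp: "taxi (place n (f x)) (place m (f y)) =
      taxi (place n (f x)) (place n p) + taxi (place n p) (place m (f y))"
    using gate[OF nm(1,2) False fx(2)] fx by metis
  \<comment> \<open>The gate out of cell \<open>m\<close> is taken towards \<open>p\<close>, not
    towards \<open>f x\<close>, so that the three legs add up along one geodesic.\<close>
  obtain q where q: "q \<in> M0" and gq: "taxi (place m (f y)) (place n p) =
      taxi (place m (f y)) (place m q) + taxi (place m q) (place n p)"
    using gate[OF nm(2,1) False[symmetric], of p] p fx M0_subset_usq by (metis subsetD)
  have 1: "reach X (n, x) (n, sqm X p) (taxi (place n (f x)) (place n p) + D / 3)"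
    using D(2)[of x "sqm X p"] nm in_car[OF p] by (intro reach_cell X) (auto simp: taxi_place fS p)
  have 2: "reach X (n, sqm X p) (m, sqm X q) (taxi (place n p) (place m q))"
    using reach_boundary[OF X bd] nm p q by simp
  have 3: "reach X (m, sqm X q) (m, y) (taxi (place m q) (place m (f y)) + D / 3)"
    using D(2)[of "sqm X q" y] nm in_car[OF q] by (intro reach_cell X) (auto simp: taxi_place fS q)
  have "taxi (place n (f x)) (place n p) + D / 3 + taxi (place n p) (place m q) +
      (taxi (place m q) (place m (f y)) + D / 3) = taxi (place n (f x)) (place m (f y)) + 2 * D / 3"
    using gp gq by (simp add: taxi_commute)
  then show ?thesis
    using reach_trans[OF reach_trans[OF 1 2] 3] by metis
qed

section \<open>Algebras\<close>

lemma alg_sqm_place: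
  assumes "is_alg A \<alpha>" "n \<in> Nset" "q \<in> usq" "place n q \<in> M0"
  shows "\<alpha> (tcls A n (sqm A q)) = sqm A (place n q)"
  using assms tsq_place[of n q A] by (auto simp: is_alg_def short_sq_map_def tensor_def)

lemma alg_dst_le_reach:
  assumes "is_alg A \<alpha>" "n \<in> Nset" "m \<in> Nset" "x \<in> car A" "y \<in> car A" "reach A (n, x) (m, y) r"
  shows "dst A (\<alpha> (tcls A n x)) (\<alpha> (tcls A m y)) \<le> r"
proof -
  have "dst A (\<alpha> (tcls A n x)) (\<alpha> (tcls A m y)) \<le> tdist A (tcls A n x) (tcls A m y)"
    using assms tcls_in_tcar[of n x A] tcls_in_tcar[of m y A]
    by (auto simp: is_alg_def short_sq_map_def tensor_def)
  also have "\<dots> \<le> r"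
    using assms by (intro tdist_le[of A "(n, x)" "(m, y)"]) (auto simp: is_alg_def)
  finally show ?thesis .
qed

text \<open>\<open>P\<close> and \<open>C\<close> are both plain pairing (horizontal crossings) or
  both swapped pairing (vertical crossings), so one induction treats both. At height 0 the crossing
  is a side of the square, of length 1 by (sq1).\<close>

lemma alg_crossing_dense:
  fixes P :: "real \<Rightarrow> real \<Rightarrow> real \<times> real" and C :: "nat \<Rightarrow> nat \<Rightarrow> nat \<times> nat"
  assumes alg: "is_alg A \<alpha>"
    and PC: "(P = Pair \<and> C = Pair) \<or> (P = (\<lambda>x y. (y, x)) \<and> C = (\<lambda>x y. (y, x)))"
    and "s \<in> {0..1}"
  shows "\<exists>t\<in>{0..1}. \<bar>s - t\<bar> \<le> (1 / 3) ^ j \<and> dst A (sqm A (P 0 t)) (sqm A (P 1 t)) \<le> 1"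
  using assms(3)
proof (induction j arbitrary: s)
  case 0
  have "dst A (sqm A (P 0 0)) (sqm A (P 1 0)) \<le> 1"
    using PC alg sqms_side1[of A 0 0 1] sqms_side2[of A 0 0 1] by (auto simp: is_alg_def)
  then show ?case using 0 by (intro bexI[of _ 0]) auto
next
  case (Suc j)
  have A: "is_sqms A" using alg by (simp add: is_alg_def)
  obtain b s' where b: "b \<le> 2" and s': "s' \<in> {0..1}" "s = (real b + s') / 3"
    using Suc.prems ternary_digit by metis
  obtain t' where t': "t' \<in> {0..1}" "\<bar>s' - t'\<bar> \<le> (1 / 3) ^ j"
    and le1: "dst A (sqm A (P 0 t')) (sqm A (P 1 t')) \<le> 1"
    using Suc.IH[OF s'(1)] by blast
  \<comment> \<open>Same row (or column) \<open>b\<close>, with the height inside it replaced by the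
    approximation \<open>t'\<close>; the error is divided by 3.\<close>
  define t where "t = (real b + t') / 3"
  have t: "t \<in> {0..1}" using b t' by (auto simp: t_def)
  have "\<bar>s - t\<bar> = \<bar>s' - t'\<bar> / 3"
    unfolding s'(2) t_def by (simp add: diff_divide_distrib[symmetric])
  then have st: "\<bar>s - t\<bar> \<le> (1 / 3) ^ Suc j" using t' by simp
  have C: "C i b \<in> Nset" if "i \<le> 2" for i
    using PC b that by (auto simp: in_Nset_iff)
  have P: "P i u \<in> M0" if "i = 0 \<or> i = 1" "u \<in> {0..1}" for i u
    using PC that by (auto simp: in_M0_iff)
  note S = sqms_sqm_in[OF A P]
  have cross: "reach A (C i b, sqm A (P 0 t')) (C i b, sqm A (P 1 t')) (1 / 3)" if "i \<le> 2" for i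
    using that C S t' le1 by (intro reach_cell A) auto
  have glue: "reach A (C i b, sqm A (P 1 t')) (C (Suc i) b, sqm A (P 0 t')) 0" if "Suc i \<le> 2" for i
  proof (rule reach_teq)
    show "((C i b, sqm A (P 1 t')), (C (Suc i) b, sqm A (P 0 t'))) \<in> teq A"
    proof (rule tgen_in_teq)
      show "adjN (C i b) (C (Suc i) b)" "place (C i b) (P 1 t') = place (C (Suc i) b) (P 0 t')"
        using PC by (auto simp: adjN_def place_def)
    qed (use that C P t' in auto)
  qed (use that C S t' in auto)
  \<comment> \<open>Three crossings of length at most 1/3, joined by two free gluings.\<close>
  have "reach A (C 0 b, sqm A (P 0 t')) (C 2 b, sqm A (P 1 t')) 1"
    using reach_trans[OF reach_trans[OF reach_trans[OF reach_trans[OF cross[of 0] glue[of 0]]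
      cross[of "Suc 0"]] glue[of "Suc 0"]] cross[of "Suc (Suc 0)"]]
    by (simp add: numeral_2_eq_2)
  then have "dst A (\<alpha> (tcls A (C 0 b) (sqm A (P 0 t')))) (\<alpha> (tcls A (C 2 b) (sqm A (P 1 t')))) \<le> 1"
    using alg_dst_le_reach[OF alg C C S S] t' by simp
  moreover have "place (C 0 b) (P 0 t') = P 0 t" "place (C 2 b) (P 1 t') = P 1 t"
    using PC by (auto simp: place_def t_def)
  ultimately have "dst A (sqm A (P 0 t)) (sqm A (P 1 t)) \<le> 1"
    using alg_sqm_place[OF alg, of "C 0 b" "P 0 t'"] alg_sqm_place[OF alg, of "C 2 b" "P 1 t'"]
      C P t t' subsetD[OF M0_subset_usq P, of 0 t'] subsetD[OF M0_subset_usq P, of 1 t'] by simp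
  then show ?case using t st by blast
qed

text \<open>The path slides along one side to a height \<open>t\<close> from
  \<open>alg_crossing_dense\<close>, crosses, and slides along the other side to \<open>u\<close>.
  Replacing \<open>s\<close> by \<open>t\<close> affects both slides, hence the constant 2 in front
  of the error.\<close>

lemma alg_opposite_sides:
  fixes P :: "real \<Rightarrow> real \<Rightarrow> real \<times> real"
  assumes alg: "is_alg A \<alpha>" and PC: "P = Pair \<or> P = (\<lambda>x y. (y, x))"
    and su: "s \<in> {0..1}" "u \<in> {0..1}"
  shows "dst A (sqm A (P 0 s)) (sqm A (P 1 u)) \<le> 1 + \<bar>s - u\<bar>"
proof (rule le_if_geometric_le[of "1 / 3" _ _ 2])
  fix j
  have A: "is_sqms A" using alg by (simp add: is_alg_def)
  obtain C :: "nat \<Rightarrow> nat \<Rightarrow> nat \<times> nat" where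
    "(P = Pair \<and> C = Pair) \<or> (P = (\<lambda>x y. (y, x)) \<and> C = (\<lambda>x y. (y, x)))"
    using PC by blast
  then obtain t where t: "t \<in> {0..1}" "\<bar>s - t\<bar> \<le> (1 / 3) ^ j"
    "dst A (sqm A (P 0 t)) (sqm A (P 1 t)) \<le> 1"
    using alg_crossing_dense[OF alg _ su(1)] by metis
  have P: "P i v \<in> M0" if "i = 0 \<or> i = 1" "v \<in> {0..1}" for i v
    using PC that by (auto simp: in_M0_iff)
  note S = sqms_sqm_in[OF A P]
  have side: "dst A (sqm A (P i v)) (sqm A (P i w)) = \<bar>v - w\<bar>"
    if "i = 0 \<or> i = 1" "v \<in> {0..1}" "w \<in> {0..1}" for i v w
    using PC sqms_side1[OF A that] sqms_side2[OF A that] by auto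
  have "dst A (sqm A (P 0 s)) (sqm A (P 1 u)) \<le>
      dst A (sqm A (P 0 s)) (sqm A (P 0 t)) + dst A (sqm A (P 0 t)) (sqm A (P 1 t)) +
      dst A (sqm A (P 1 t)) (sqm A (P 1 u))"
    using sqms_triangle[OF A S[of 0 s] S[of 0 t] S[of 1 u]]
      sqms_triangle[OF A S[of 0 t] S[of 1 t] S[of 1 u]] su t by simp
  also have "\<dots> \<le> \<bar>s - t\<bar> + 1 + \<bar>t - u\<bar>"
    using side[of 0 s t] side[of 1 t u] su t by simp
  also have "\<dots> \<le> 1 + \<bar>s - u\<bar> + 2 * (1 / 3) ^ j"
    using t(2) by linarith
  finally show "dst A (sqm A (P 0 s)) (sqm A (P 1 u)) \<le> 1 + \<bar>s - u\<bar> + 2 * (1 / 3) ^ j" .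
qed auto

text \<open>Points on one side or on opposite sides are settled by (sq1) and
  \<open>alg_opposite_sides\<close>. On adjacent sides, the path through the common corner is a
  taxicab geodesic.\<close>

lemma alg_boundary_taxi:
  assumes alg: "is_alg A \<alpha>" and "p \<in> M0" "q \<in> M0"
  shows "dst A (sqm A p) (sqm A q) \<le> taxi p q"
proof -
  have A: "is_sqms A" using alg by (simp add: is_alg_def)
  obtain r s t u where pq: "p = (r, s)" "q = (t, u)" by (metis surj_pair)
  have I: "r \<in> {0..1}" "s \<in> {0..1}" "t \<in> {0..1}" "u \<in> {0..1}"
    using assms by (auto simp: pq in_M0_iff)
  note side1 = sqms_side1[OF A] and side2 = sqms_side2[OF A]
  note opp1 = alg_opposite_sides[OF alg, of Pair] and opp2 = alg_opposite_sides[OF alg, of "\<lambda>x y. (y, x)"]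
  have sym: "dst A (sqm A p) (sqm A q) = dst A (sqm A q) (sqm A p)"
    using assms sqms_sqm_in[OF A] sqms_commute[OF A] by blast
  have corner: "dst A (sqm A p) (sqm A q) \<le> dst A (sqm A p) (sqm A v) + dst A (sqm A v) (sqm A q)"
    if "v \<in> M0" for v
    using sqms_triangle[OF A] sqms_sqm_in[OF A] assms that by blast
  consider "r = 0 \<or> r = 1" "t = 0 \<or> t = 1" | "s = 0 \<or> s = 1" "u = 0 \<or> u = 1"
    | "r = 0 \<or> r = 1" "u = 0 \<or> u = 1" | "s = 0 \<or> s = 1" "t = 0 \<or> t = 1"
    using assms by (auto simp: pq in_M0_iff)
  then show ?thesis
  proof cases
    case 1
    then show ?thesis
      using side1[of r s u] opp1[of s u] opp1[of u s] sym I by (auto simp: pq taxi_def)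
  next
    case 2
    then show ?thesis
      using side2[of s r t] opp2[of r t] opp2[of t r] sym I by (auto simp: pq taxi_def)
  next
    case 3
    then have "dst A (sqm A p) (sqm A (r, u)) = \<bar>s - u\<bar>" "dst A (sqm A (r, u)) (sqm A q) = \<bar>r - t\<bar>"
      using side1[of r s u] side2[of u r t] I by (auto simp: pq)
    moreover have "(r, u) \<in> M0" using 3 I by (auto simp: in_M0_iff)
    ultimately show ?thesis
      using corner[of "(r, u)"] by (simp add: taxi_def pq)
  next
    case 4
    then have "dst A (sqm A p) (sqm A (t, s)) = \<bar>r - t\<bar>" "dst A (sqm A (t, s)) (sqm A q) = \<bar>s - u\<bar>"
      using side2[of s r t] side1[of t s u] I by (auto simp: pq)
    moreover have "(t, s) \<in> M0" using 4 I by (auto simp: in_M0_iff)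
    ultimately show ?thesis
      using corner[of "(t, s)"] by (simp add: taxi_def pq)
  qed
qed

section \<open>The initial algebra is a dense part of the unit square\<close>

lemma alg_maps_to: "is_alg A \<alpha> \<Longrightarrow> n \<in> Nset \<Longrightarrow> x \<in> car A \<Longrightarrow> \<alpha> (tcls A n x) \<in> car A"
  using tcls_in_tcar[of n x A] by (auto simp: is_alg_def short_sq_map_def tensor_def)

text \<open>Gluing sees \<open>X\<close> only through \<open>sqm\<close>, so restricting the carrier
  does not change the relation.\<close>

lemma teq_cong: "sqm X = sqm Y \<Longrightarrow> teq X = teq Y"
  by (simp add: teq_def tgen_def)

lemma tcls_cong: "sqm X = sqm Y \<Longrightarrow> tcls X = tcls Y"
  using teq_cong[of X Y] by (auto simp: tcls_def fun_eq_iff)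

text \<open>The image of the structure map is a subalgebra, so by initiality it is everything.\<close>

lemma initial_alg_surj:
  assumes init: "initial_alg W lam" and w: "w \<in> car W"
  obtains n x where "n \<in> Nset" "x \<in> car W" "w = lam (tcls W n x)"
proof -
  have alg: "is_alg W lam" using init by (simp add: initial_alg_def)
  have W: "is_sqms W" using alg by (simp add: is_alg_def)
  define B where "B = W\<lparr>car := lam ` tcar W\<rparr>"
  have [simp]: "car B = lam ` tcar W" "dst B = dst W" "sqm B = sqm W"
    by (simp_all add: B_def)
  have sub: "car B \<subseteq> car W"
    using alg by (auto simp: is_alg_def short_sq_map_def tensor_def)
  have SB: "sqm W ` M0 \<subseteq> car B"
  proof clarsimp
    fix a b assume ab: "(a, b) \<in> M0"
    obtain n q where nq: "n \<in> Nset" "q \<in> usq" "place n q = (a, b)"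
      using ab M0_subset_usq usq_place by (metis subsetD)
    then have "q \<in> M0" using place_in_M0_D[of n q] ab by simp
    then have "tcls W n (sqm W q) \<in> tcar W"
      using nq sqms_sqm_in[OF W] by (intro tcls_in_tcar) auto
    moreover have "sqm W (a, b) = lam (tcls W n (sqm W q))"
      using alg_sqm_place[OF alg nq(1,2)] nq(3) ab by simp
    ultimately show "sqm W (a, b) \<in> lam ` tcar W" by blast
  qed
  have B: "is_sqms B"
    using W sub SB unfolding is_sqms_def is_metric_on_def
    by (simp add: subset_iff)
  have tcls: "tcls B = tcls W" by (rule tcls_cong) simp
  have teq: "teq B = teq W" by (rule teq_cong) simp
  have tcar: "tcar B \<subseteq> tcar W"
  proof
    fix c assume "c \<in> tcar B"
    then obtain n x where "n \<in> Nset" "x \<in> car B" "c = tcls B n x" by (rule tcarE)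
    then show "c \<in> tcar W" using sub tcls_in_tcar[of n x W] by (auto simp: tcls)
  qed
  \<comment> \<open>Every chain in \<open>B\<close> is a chain in \<open>W\<close>, so quotient
    distances do not decrease and \<open>lam\<close> stays short on \<open>B\<close>.\<close>
  have tdist: "tdist W c c' \<le> tdist B c c'" if "c \<in> tcar B" "c' \<in> tcar B" for c c'
  proof (rule tdist_ge[OF that])
    fix zs assume zs: "zs \<noteq> []" "set zs \<subseteq> Nset \<times> car B" "hd zs \<in> c" "last zs \<in> c'"
    have "tstep B = tstep W"
      by (simp add: tstep_def tbase_def teq fun_eq_iff)
    moreover have "set zs \<subseteq> Nset \<times> car W" using zs sub by blast
    ultimately have "reach W (hd zs) (last zs) (cost B zs)"
      unfolding reach_def using zs by (intro exI[of _ zs]) auto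
    then show "tdist W c c' \<le> cost B zs"
      using tdist_le[OF W] zs by blast
  qed
  have "tsq B = tsq W"
    by (simp add: tsq_def tcls fun_eq_iff)
  then have "short_sq_map (tensor B) B lam"
    using alg tcar tdist unfolding is_alg_def short_sq_map_def tensor_def
    by simp (meson image_mono order_trans subsetD)
  then have "is_alg B lam" using B by (simp add: is_alg_def)
  \<comment> \<open>Lambek's argument: followed by the inclusion of \<open>B\<close>,
    \<open>h\<close> is an endomorphism of \<open>W\<close>, and so is the identity. Uniqueness
    makes them agree, so \<open>w = h w\<close> lies in the image.\<close>
  then obtain h where h: "alg_mor W lam B lam h"
    using init unfolding initial_alg_def by blast
  have "tmap B h = tmap W h"
    by (simp add: tmap_def tcls fun_eq_iff)
  then have h_end: "alg_mor W lam W lam h"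
    using h sub by (simp add: alg_mor_def short_sq_map_def) (meson order_trans)
  have id_end: "alg_mor W lam W lam (\<lambda>x. x)"
  proof -
    have "tmap W (\<lambda>x. x) c = c" if "c \<in> tcar W" for c
      using tcar_memD(3)[OF that tcar_some_in[OF that]] sqms_sqm_in[OF W]
      by (simp add: tmap_def Let_def image_subset_iff)
    then show ?thesis
      by (auto simp: alg_mor_def short_sq_map_def tensor_def)
  qed
  obtain g where g: "\<And>h'. alg_mor W lam W lam h' \<Longrightarrow> \<forall>x\<in>car W. h' x = g x"
    using init[unfolded initial_alg_def, THEN conjunct2, rule_format, OF alg] by blast
  have "h w = w"
    using g[OF h_end] g[OF id_end] w by simp
  moreover have "h w \<in> lam ` tcar W"
    using h w by (auto simp: alg_mor_def short_sq_map_def)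
  ultimately obtain c where c: "c \<in> tcar W" "w = lam c"
    by auto
  from c(1) obtain n x where "n \<in> Nset" "x \<in> car W" "c = tcls W n x"
    by (rule tcarE)
  then show thesis
    using c(2) by (intro that) auto
qed

text \<open>Initiality only speaks about algebras on the type of \<open>W\<close>, so the unit square is first copied
  into that type; there is room for it because \<open>W\<close> contains a copy of the unit interval.\<close>

lemma usq_embeds:
  fixes W :: "'w sqms"
  assumes "is_sqms W"
  obtains j :: "real \<times> real \<Rightarrow> 'w" where "inj_on j usq"
proof -
  have "(card_of usq, card_of {0..1::real}) \<in> ordIso"
    by (rule card_of_Times_same_infinite) (simp add: infinite_Icc)
  then obtain g where g: "bij_betw g usq {0..1::real}"
    using card_of_ordIso by blast
  have "inj_on (\<lambda>r. sqm W (r, 0)) {0..1}"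
    using inj_onD[OF sqms_inj[OF assms]] by (intro inj_onI) (fastforce simp: in_M0_iff)
  then have "inj_on ((\<lambda>r. sqm W (r, 0)) \<circ> g) usq"
    using g by (intro comp_inj_on) (auto simp: bij_betw_def)
  then show thesis by (rule that)
qed

text \<open>The algebra \<open>B\<close> is the square with structure map \<open>place\<close>,
  transported to the type of \<open>W\<close> along \<open>j\<close>; \<open>f\<close> is the
  morphism given by initiality, read back through \<open>k\<close>.\<close>

lemma initial_alg_to_usq:
  fixes W :: "'w sqms"
  assumes init: "initial_alg W lam"
  obtains f :: "'w \<Rightarrow> real \<times> real" where "f ` car W \<subseteq> usq"
    "\<And>x y. x \<in> car W \<Longrightarrow> y \<in> car W \<Longrightarrow> taxi (f x) (f y) \<le> dst W x y"
    "\<And>p. p \<in> M0 \<Longrightarrow> f (sqm W p) = p"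
    "\<And>n x. n \<in> Nset \<Longrightarrow> x \<in> car W \<Longrightarrow> f (lam (tcls W n x)) = place n (f x)"
proof -
  have alg: "is_alg W lam" using init by (simp add: initial_alg_def)
  have W: "is_sqms W" using alg by (simp add: is_alg_def)
  obtain j :: "real \<times> real \<Rightarrow> 'w" where j: "inj_on j usq" using usq_embeds[OF W] by blast
  define k where "k = inv_into usq j"
  have kj: "k (j p) = p" if "p \<in> usq" for p
    using j that by (simp add: k_def inv_into_f_f)
  have kM: "k (j p) = p" if "p \<in> M0" for p
    using that M0_subset_usq kj by blast
  define B where "B = \<lparr>car = j ` usq, dst = (\<lambda>x y. taxi (k x) (k y)), sqm = j\<rparr>"
  have [simp]: "car B = j ` usq" "dst B x y = taxi (k x) (k y)" "sqm B = j" for x y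
    by (simp_all add: B_def)
  have k_usq: "k ` car B \<subseteq> usq" using kj by auto
  have B: "is_sqms B"
    unfolding is_sqms_def is_metric_on_def
  proof (intro conjI)
    show "inj_on (sqm B) M0" using j M0_subset_usq inj_on_subset by fastforce
    show "sqm B ` M0 \<subseteq> car B" using M0_subset_usq by auto
    show "\<forall>i\<in>{0, 1}. \<forall>r\<in>{0..1}. \<forall>s\<in>{0..1}. dst B (sqm B (i, r)) (sqm B (i, s)) = \<bar>s - r\<bar> \<and>
        dst B (sqm B (r, i)) (sqm B (s, i)) = \<bar>s - r\<bar>"
      using kj by (auto simp: taxi_def)
    show "\<forall>r s t u. (r, s) \<in> M0 \<longrightarrow> (t, u) \<in> M0 \<longrightarrow>
        \<bar>r - t\<bar> + \<bar>s - u\<bar> \<le> dst B (sqm B (r, s)) (sqm B (t, u))"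
      using kM by (auto simp: taxi_def)
    show "\<forall>x\<in>car B. \<forall>y\<in>car B. dst B x y \<le> 2"
      using kj taxi_le_2 by simp
    show "\<forall>x\<in>car B. \<forall>y\<in>car B. 0 \<le> dst B x y \<and> dst B x y = dst B y x \<and> (dst B x y = 0) = (x = y)"
      using kj taxi_commute by (auto simp: inj_on_eq_iff[OF j])
    show "\<forall>x\<in>car B. \<forall>y\<in>car B. \<forall>z\<in>car B. dst B x z \<le> dst B x y + dst B y z"
      using taxi_triangle by auto
  qed
  have SB: "sqm B ` M0 \<subseteq> car B" using M0_subset_usq by auto
  define \<beta> where "\<beta> c = (let z = (SOME z. z \<in> c) in j (place (fst z) (k (snd z))))" for c
  have \<beta>_tcls: "\<beta> (tcls B n x) = j (place n (k x))" for n x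
  proof -
    have "(SOME z. z \<in> tcls B n x) \<in> tcls B n x"
      using self_in_tcls by (rule someI)
    then have "place n (k x) = place (fst (SOME z. z \<in> tcls B n x)) (k (snd (SOME z. z \<in> tcls B n x)))"
      using teq_place[of "(n, x)" _ B k] kM by (simp add: in_tcls_iff)
    then show ?thesis by (simp add: \<beta>_def Let_def)
  qed
  have place_k: "place n (k x) \<in> usq" if "n \<in> Nset" "x \<in> car B" for n x
    using that k_usq by (intro place_in_usq) auto
  have "short_sq_map (tensor B) B \<beta>"
    unfolding short_sq_map_def
  proof (intro conjI ballI)
    show "\<beta> ` car (tensor B) \<subseteq> car B"
      using place_k by (auto simp: tensor_def \<beta>_tcls elim!: tcarE)
    show "dst B (\<beta> c) (\<beta> c') \<le> dst (tensor B) c c'"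
      if "c \<in> car (tensor B)" "c' \<in> car (tensor B)" for c c'
    proof -
      have c: "c \<in> tcar B" "c' \<in> tcar B" using that by (auto simp: tensor_def)
      obtain n x where nx: "n \<in> Nset" "x \<in> car B" "c = tcls B n x" using c(1) by (rule tcarE)
      obtain m y where my: "m \<in> Nset" "y \<in> car B" "c' = tcls B m y" using c(2) by (rule tcarE)
      \<comment> \<open>Distances in \<open>B\<close> are pulled back along \<open>k\<close>, so the
        additive error is 0.\<close>
      have "taxi (place n (k x)) (place m (k y)) \<le> tdist B c c' + 2 * 0 / 3"
        using tdist_lower_bound[OF B k_usq, of 0 c c' "(n, x)" "(m, y)"] kM c nx my by simp
      moreover have "dst B (\<beta> c) (\<beta> c') = taxi (place n (k x)) (place m (k y))"
        using nx my place_k kj by (simp add: \<beta>_tcls)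
      ultimately show ?thesis by (simp add: tensor_def)
    qed
    show "\<beta> (sqm (tensor B) p) = sqm B p" if p: "p \<in> M0" for p
    proof -
      obtain n q where nq: "n \<in> Nset" "q \<in> usq" "place n q = p"
        using p M0_subset_usq usq_place by (metis subsetD)
      then show ?thesis
        using tsq_place[of n q B] p kj by (simp add: tensor_def \<beta>_tcls)
    qed
  qed
  then have "is_alg B \<beta>" using B by (simp add: is_alg_def)
  then obtain h where h: "alg_mor W lam B \<beta> h"
    using init unfolding initial_alg_def by blast
  then have h1: "h ` car W \<subseteq> car B" and h2: "\<And>x y. x \<in> car W \<Longrightarrow> y \<in> car W \<Longrightarrow> taxi (k (h x)) (k (h y)) \<le> dst W x y"
    and h3: "\<And>p. p \<in> M0 \<Longrightarrow> h (sqm W p) = j p"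
    and h4: "\<And>c. c \<in> tcar W \<Longrightarrow> h (lam c) = \<beta> (tmap B h c)"
    unfolding alg_mor_def short_sq_map_def by (auto simp: tensor_def)
  show thesis
  proof (rule that[of "\<lambda>x. k (h x)"])
    show "(\<lambda>x. k (h x)) ` car W \<subseteq> usq" using h1 k_usq by blast
    show kh: "k (h (sqm W p)) = p" if "p \<in> M0" for p using h3 kM that by simp
    show "k (h (lam (tcls W n x))) = place n (k (h x))" if nx: "n \<in> Nset" "x \<in> car W" for n x
    proof -
      let ?c = "tcls W n x"
      define z where "z = (SOME z. z \<in> ?c)"
      have c: "?c \<in> tcar W" using nx by (rule tcls_in_tcar)
      have z: "z \<in> ?c" unfolding z_def using c by (rule tcar_some_in)
      have "h (lam ?c) = \<beta> (tcls B (fst z) (h (snd z)))"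
        using h4[OF c] by (simp add: tmap_def z_def Let_def)
      also have "\<dots> = j (place (fst z) (k (h (snd z))))" by (rule \<beta>_tcls)
      also have "place (fst z) (k (h (snd z))) = place n (k (h x))"
        using teq_place[of "(n, x)" z W "\<lambda>x. k (h x)"] z kh by (simp add: in_tcls_iff)
      finally show ?thesis
        using kj[OF place_k[OF nx(1), of "h x"]] h1 nx by auto
    qed
  qed (use h2 in auto)
qed

text \<open>The bound 2 on distances starts the distortion at \<open>D = 2\<close>. As every point
  is a value of \<open>lam\<close>, \<open>reach_upper_bound\<close> applies to preimages and
  multiplies it by 2/3; exactness on cell boundaries comes from
  \<open>alg_boundary_taxi\<close>.\<close>

lemma initial_alg_isometric:
  assumes init: "initial_alg W lam" and f: "f ` car W \<subseteq> usq"
    and fS: "\<And>p. p \<in> M0 \<Longrightarrow> f (sqm W p) = p"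
    and flam: "\<And>n x. n \<in> Nset \<Longrightarrow> x \<in> car W \<Longrightarrow> f (lam (tcls W n x)) = place n (f x)"
    and "x \<in> car W" "y \<in> car W"
  shows "dst W x y \<le> taxi (f x) (f y)"
proof -
  have alg: "is_alg W lam" using init by (simp add: initial_alg_def)
  have W: "is_sqms W" using alg by (simp add: is_alg_def)
  have bound: "dst W x y \<le> taxi (f x) (f y) + 2 * (2 / 3) ^ k" if "x \<in> car W" "y \<in> car W" for k x y
    using that
  proof (induction k arbitrary: x y)
    case 0
    then show ?case using sqms_le_2[OF W, of x y] taxi_nonneg[of "f x" "f y"]
      unfolding power_0 by linarith
  next
    case (Suc k)
    obtain n x' where x: "n \<in> Nset" "x' \<in> car W" "x = lam (tcls W n x')"
      using initial_alg_surj[OF init Suc.prems(1)] by blast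
    obtain m y' where y: "m \<in> Nset" "y' \<in> car W" "y = lam (tcls W m y')"
      using initial_alg_surj[OF init Suc.prems(2)] by blast
    have "reach W (n, x') (m, y') (taxi (place n (f x')) (place m (f y')) + 2 * (2 * (2 / 3) ^ k) / 3)"
      using x y Suc.IH by (intro reach_upper_bound[OF W alg_boundary_taxi[OF alg] f fS]) auto
    then have "dst W x y \<le> taxi (place n (f x')) (place m (f y')) + 2 * (2 * (2 / 3) ^ k) / 3"
      using alg_dst_le_reach[OF alg] x y by simp
    then show ?case using flam x y by simp
  qed
  show ?thesis
    by (rule le_if_geometric_le[OF _ _ bound[OF assms(5,6)]]) simp_all
qed

text \<open>Approximating \<open>q\<close> inside its cell and then applying \<open>lam\<close>
  divides the error by 3.\<close>

lemma alg_dense: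
  assumes alg: "is_alg W lam"
    and fS: "\<And>p. p \<in> M0 \<Longrightarrow> f (sqm W p) = p" and f: "f ` car W \<subseteq> usq"
    and flam: "\<And>n x. n \<in> Nset \<Longrightarrow> x \<in> car W \<Longrightarrow> f (lam (tcls W n x)) = place n (f x)"
    and "q \<in> usq"
  shows "\<exists>w\<in>car W. taxi (f w) q \<le> 2 * (1 / 3) ^ k"
  using \<open>q \<in> usq\<close>
proof (induction k arbitrary: q)
  case 0
  have "sqm W (0, 0) \<in> car W"
    using alg sqms_sqm_in[of W "(0, 0)"] by (simp add: is_alg_def in_M0_iff)
  then show ?case
    using 0 taxi_le_2[of "f (sqm W (0, 0))" q] f by (auto intro!: bexI[of _ "sqm W (0, 0)"])
next
  case (Suc k)
  obtain n r where n: "n \<in> Nset" "r \<in> usq" "place n r = q" using Suc.prems usq_place by blast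
  obtain w where w: "w \<in> car W" "taxi (f w) r \<le> 2 * (1 / 3) ^ k" using Suc.IH[OF n(2)] by blast
  have "taxi (f (lam (tcls W n w))) q = taxi (f w) r / 3"
    using flam[OF n(1) w(1)] n(3) taxi_place by metis
  then show ?case
    using w alg_maps_to[OF alg n(1) w(1)] by (intro bexI[of _ "lam (tcls W n w)"]) auto
qed

section \<open>The completion is the unit square\<close>

lemma tendsto_taxi:
  assumes "(f \<longlongrightarrow> l) F" "(g \<longlongrightarrow> m) F"
  shows "((\<lambda>i. taxi (f i) (g i)) \<longlongrightarrow> taxi l m) F"
  unfolding taxi_def by (intro tendsto_intros assms)

text \<open>The completion is computed from a dense isometric copy of \<open>W\<close> inside the
  square. Density carries a rate, which turns approximations directly into Cauchy sequences.\<close>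

locale square_chart =
  fixes W :: "'w sqms" and f :: "'w \<Rightarrow> real \<times> real"
  assumes sqms: "is_sqms W"
    and chart_usq: "x \<in> car W \<Longrightarrow> f x \<in> usq"
    and chart_sqm: "p \<in> M0 \<Longrightarrow> f (sqm W p) = p"
    and chart_isometric: "x \<in> car W \<Longrightarrow> y \<in> car W \<Longrightarrow> dst W x y = taxi (f x) (f y)"
    and chart_dense: "q \<in> usq \<Longrightarrow> \<exists>w\<in>car W. taxi (f w) q \<le> 2 * (1 / 3) ^ k"
begin

definition seq_limit :: "(nat \<Rightarrow> 'w) \<Rightarrow> real \<times> real" where
  "seq_limit x = lim (\<lambda>i. f (x i))"

definition cchart :: "(nat \<Rightarrow> 'w) set \<Rightarrow> real \<times> real" where
  "cchart c = seq_limit (SOME x. x \<in> c)"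

lemma cauchy_in_car: "cauchy_in W x \<Longrightarrow> x i \<in> car W"
  by (auto simp: cauchy_in_def)

lemma cauchy_tendsto:
  assumes "cauchy_in W x"
  shows "(\<lambda>i. f (x i)) \<longlonglongrightarrow> seq_limit x"
proof -
  have "Cauchy (\<lambda>i. f (x i))"
  proof (rule metric_CauchyI)
    fix e :: real assume "0 < e"
    then obtain M where M: "\<And>m n. M \<le> m \<Longrightarrow> M \<le> n \<Longrightarrow> dst W (x m) (x n) < e"
      using assms unfolding cauchy_in_def by blast
    have "dist (f (x m)) (f (x n)) < e" if "M \<le> m" "M \<le> n" for m n
      using dist_le_taxi[of "f (x m)" "f (x n)"] M[OF that] chart_isometric cauchy_in_car[OF assms]
      by (metis le_less_trans)
    then show "\<exists>M. \<forall>m\<ge>M. \<forall>n\<ge>M. dist (f (x m)) (f (x n)) < e" by blast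
  qed
  then show ?thesis
    unfolding seq_limit_def by (simp add: Cauchy_convergent_iff convergent_LIMSEQ_iff)
qed

lemma seq_limitI: "cauchy_in W x \<Longrightarrow> (\<lambda>i. f (x i)) \<longlonglongrightarrow> l \<Longrightarrow> seq_limit x = l"
  using cauchy_tendsto LIMSEQ_unique by blast

lemma seq_limit_usq:
  assumes "cauchy_in W x"
  shows "seq_limit x \<in> usq"
proof (rule Lim_in_closed_set[OF _ _ _ cauchy_tendsto[OF assms]])
  show "closed usq" by (intro closed_Times) auto
qed (use chart_usq cauchy_in_car[OF assms] in auto)

text \<open>\<open>f\<close> is isometric and \<open>taxi\<close> continuous, so the distances
  between two Cauchy sequences converge to the distance of their limits in the square.\<close>

lemma ceq_iff: "(x, y) \<in> ceq W \<longleftrightarrow> cauchy_in W x \<and> cauchy_in W y \<and> seq_limit x = seq_limit y"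
proof -
  have "(\<lambda>i. dst W (x i) (y i)) \<longlonglongrightarrow> 0 \<longleftrightarrow> seq_limit x = seq_limit y"
    if xy: "cauchy_in W x" "cauchy_in W y"
  proof -
    have "(\<lambda>i. dst W (x i) (y i)) \<longlonglongrightarrow> taxi (seq_limit x) (seq_limit y)"
      using tendsto_taxi[OF cauchy_tendsto[OF xy(1)] cauchy_tendsto[OF xy(2)]]
      by (simp add: chart_isometric cauchy_in_car xy)
    then show ?thesis
      using LIMSEQ_unique taxi_eq_0_iff by metis
  qed
  then show ?thesis by (auto simp: ceq_def)
qed

lemma ceq_class_in_ccar: "cauchy_in W x \<Longrightarrow> ceq W `` {x} \<in> ccar W"
  by (auto simp: ccar_def intro: quotientI)

text \<open>Frees \<open>cchart\<close> from the representative chosen by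
  \<open>SOME\<close>.\<close>

lemma ccar_memD:
  assumes "c \<in> ccar W" "x \<in> c"
  shows "cauchy_in W x" "cchart c = seq_limit x" "c = ceq W `` {x}"
proof -
  obtain y where y: "c = ceq W `` {y}" "cauchy_in W y"
    using assms(1) by (auto simp: ccar_def elim: quotientE)
  have mem: "z \<in> c \<longleftrightarrow> cauchy_in W z \<and> seq_limit z = seq_limit y" for z
    using y by (auto simp: ceq_iff)
  have "(SOME x. x \<in> c) \<in> c" using assms(2) by (auto simp: some_in_eq)
  then show "cauchy_in W x" "cchart c = seq_limit x" "c = ceq W `` {x}"
    using assms(2) y by (auto simp: cchart_def mem ceq_iff)
qed

lemma ccar_some_in:
  assumes "c \<in> ccar W"
  shows "(SOME x. x \<in> c) \<in> c"
proof -
  obtain y where "c = ceq W `` {y}" "cauchy_in W y"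
    using assms by (auto simp: ccar_def elim: quotientE)
  then have "y \<in> c" by (simp add: ceq_iff)
  then show ?thesis by (auto simp: some_in_eq)
qed

lemma cchart_class: "cauchy_in W x \<Longrightarrow> cchart (ceq W `` {x}) = seq_limit x"
  by (intro ccar_memD(2) ceq_class_in_ccar) (auto simp: ceq_iff)

lemma cchart_isometric:
  assumes "c \<in> ccar W" "c' \<in> ccar W"
  shows "cdist W c c' = taxi (cchart c) (cchart c')"
proof -
  let ?x = "SOME x. x \<in> c" and ?y = "SOME y. y \<in> c'"
  have xy: "cauchy_in W ?x" "cauchy_in W ?y"
    using ccar_memD(1) ccar_some_in assms by blast+
  have "(\<lambda>i. dst W (?x i) (?y i)) \<longlonglongrightarrow> taxi (cchart c) (cchart c')"
    using tendsto_taxi[OF cauchy_tendsto[OF xy(1)] cauchy_tendsto[OF xy(2)]]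
    by (simp add: chart_isometric cauchy_in_car xy cchart_def)
  then show ?thesis
    unfolding cdist_def by (rule limI)
qed

lemma cchart_usq: "c \<in> ccar W \<Longrightarrow> cchart c \<in> usq"
  using ccar_memD ccar_some_in seq_limit_usq by metis

lemma cchart_bij: "bij_betw cchart (ccar W) usq"
proof (rule bij_betw_imageI)
  show "inj_on cchart (ccar W)"
  proof (rule inj_onI)
    fix c c' assume c: "c \<in> ccar W" "c' \<in> ccar W" "cchart c = cchart c'"
    define x y where "x = (SOME x. x \<in> c)" and "y = (SOME x. x \<in> c')"
    have xy: "x \<in> c" "y \<in> c'" using c ccar_some_in by (auto simp: x_def y_def)
    have "(x, y) \<in> ceq W"
      using ccar_memD[OF c(1) xy(1)] ccar_memD[OF c(2) xy(2)] c(3) by (simp add: ceq_iff)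
    then have "y \<in> c" using ccar_memD(3)[OF c(1) xy(1)] by auto
    then show "c = c'" using ccar_memD(3)[OF c(1)] ccar_memD(3)[OF c(2) xy(2)] by metis
  qed
  show "cchart ` ccar W = usq"
  proof
    show "cchart ` ccar W \<subseteq> usq" using cchart_usq by blast
    show "usq \<subseteq> cchart ` ccar W"
    proof
      fix q :: "real \<times> real" assume q: "q \<in> usq"
      \<comment> \<open>Density at every scale yields a sequence whose chart converges geometrically
        to \<open>q\<close>.\<close>
      obtain x where x: "\<And>k. x k \<in> car W" "\<And>k. taxi (f (x k)) q \<le> 2 * (1 / 3) ^ k"
        using chart_dense[OF q] by metis
      have "(\<lambda>k. 2 * (1 / 3 :: real) ^ k) \<longlonglongrightarrow> 2 * 0"
        by (intro tendsto_mult tendsto_const LIMSEQ_power_zero) simp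
      then have lim0: "(\<lambda>k. taxi (f (x k)) q) \<longlonglongrightarrow> 0"
        by (intro Lim_null_comparison[of "\<lambda>k. taxi (f (x k)) q" "\<lambda>k. 2 * (1 / 3) ^ k"])
          (simp_all add: x(2))
      have cx: "cauchy_in W x"
        unfolding cauchy_in_def
      proof (intro conjI allI impI)
        fix e :: real assume "0 < e"
        then have "eventually (\<lambda>k. taxi (f (x k)) q < e / 2) sequentially"
          using lim0 by (intro order_tendstoD) auto
        then obtain M where M: "\<And>k. M \<le> k \<Longrightarrow> taxi (f (x k)) q < e / 2"
          by (auto simp: eventually_sequentially)
        have "dst W (x m) (x n) < e" if "M \<le> m" "M \<le> n" for m n
          using M[OF that(1)] M[OF that(2)] taxi_triangle[of "f (x m)" "f (x n)" q]
            taxi_commute[of q] chart_isometric[OF x(1) x(1)] by fastforce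
        then show "\<exists>M. \<forall>m n. M \<le> m \<longrightarrow> M \<le> n \<longrightarrow> dst W (x m) (x n) < e" by blast
      qed (use x in auto)
      have "(\<lambda>k. f (x k)) \<longlonglongrightarrow> q"
        by (rule metric_tendsto_imp_tendsto[OF lim0]) (simp add: dist_le_taxi)
      then have "cchart (ceq W `` {x}) = q"
        using cchart_class[OF cx] seq_limitI[OF cx] by simp
      then show "q \<in> cchart ` ccar W"
        using ceq_class_in_ccar[OF cx] by blast
    qed
  qed
qed

lemma csq_chart:
  assumes "p \<in> M0"
  shows "csq W p \<in> ccar W" "cchart (csq W p) = p"
proof -
  have p: "sqm W p \<in> car W" using sqms_sqm_in[OF sqms assms] .
  have c: "cauchy_in W (\<lambda>i. sqm W p)"
    using p sqms_eq_0_iff[OF sqms p p] by (auto simp: cauchy_in_def)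
  then show "csq W p \<in> ccar W"
    unfolding csq_def by (rule ceq_class_in_ccar)
  have "(\<lambda>i::nat. f (sqm W p)) \<longlonglongrightarrow> p" using chart_sqm[OF assms] by simp
  then show "cchart (csq W p) = p"
    using cchart_class[OF c] seq_limitI[OF c] by (simp add: csq_def)
qed

text \<open>\<open>theta\<close> hides three choices: a representative \<open>z\<close> of the
  tensor class, a sequence \<open>x\<close> in its second component, and a sequence
  \<open>u'\<close> equivalent to \<open>u\<close>. They are harmless because places are invariant
  under gluing, \<open>cchart\<close> does not depend on the sequence, and \<open>lam\<close> is
  short, so \<open>u\<close> and \<open>u'\<close> lead to the same limit.\<close>

lemma theta_chart:
  assumes alg: "is_alg W lam"
    and flam: "\<And>n x. n \<in> Nset \<Longrightarrow> x \<in> car W \<Longrightarrow> f (lam (tcls W n x)) = place n (f x)"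
    and nv: "n \<in> Nset" "v \<in> ccar W"
  shows "theta W lam (tcls (completion W) n v) \<in> ccar W"
    and "cchart (theta W lam (tcls (completion W) n v)) = place n (cchart v)"
proof -
  let ?V = "completion W"
  have V: "car ?V = ccar W" "sqm ?V = csq W" by (simp_all add: completion_def)
  have SV: "sqm ?V ` M0 \<subseteq> car ?V" using csq_chart by (auto simp: V)
  define c where "c = tcls ?V n v"
  have c: "c \<in> tcar ?V" unfolding c_def using nv by (intro tcls_in_tcar) (auto simp: V)
  define z where "z = (SOME z. z \<in> c)"
  have z: "z \<in> c" unfolding z_def using c by (rule tcar_some_in)
  obtain m v' where mv: "z = (m, v')" by (cases z)
  have m: "m \<in> Nset" and v': "v' \<in> ccar W"
    using tcar_memD(1,2)[OF c z SV] by (auto simp: mv V)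
  have "((n, v), z) \<in> teq ?V" using z by (simp add: c_def in_tcls_iff)
  then have place_eq: "place m (cchart v') = place n (cchart v)"
    using teq_place[of "(n, v)" z ?V cchart] csq_chart(2) by (simp add: V mv)
  define x where "x = (SOME x. x \<in> v')"
  have "x \<in> v'" unfolding x_def using v' by (rule ccar_some_in)
  then have x: "cauchy_in W x" "cchart v' = seq_limit x" using ccar_memD[OF v'] by auto
  define u where "u = (\<lambda>k. tcls W m (x k))"
  have u_car: "u k \<in> tcar W" for k
    unfolding u_def using m cauchy_in_car[OF x(1)] by (rule tcls_in_tcar)
  have tdist_u: "tdist W (u k) (u l) \<le> dst W (x k) (x l) / 3" for k l
    unfolding u_def using m cauchy_in_car[OF x(1)]
    by (intro tdist_le[OF sqms, of "(m, x k)" "(m, x l)"] reach_cell sqms) auto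
  have tdist_nonneg: "0 \<le> tdist W d d'" if "d \<in> tcar W" "d' \<in> tcar W" for d d'
    using that by (intro tdist_ge cost_nonneg sqms) auto
  have u: "cauchy_in (tensor W) u"
    unfolding cauchy_in_def
  proof (intro conjI allI impI)
    show "range u \<subseteq> car (tensor W)" using u_car by (auto simp: tensor_def)
    fix e :: real assume "0 < e"
    then obtain M where M: "\<And>m n. M \<le> m \<Longrightarrow> M \<le> n \<Longrightarrow> dst W (x m) (x n) < e"
      using x(1) unfolding cauchy_in_def by blast
    have "dst (tensor W) (u k) (u l) < e" if "M \<le> k" "M \<le> l" for k l
      using tdist_u[of k l] M[OF that] \<open>0 < e\<close> by (simp add: tensor_def)
    then show "\<exists>M. \<forall>m n. M \<le> m \<longrightarrow> M \<le> n \<longrightarrow> dst (tensor W) (u m) (u n) < e" by blast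
  qed
  \<comment> \<open>Puts \<open>u\<close> into its own class, so that the choice \<open>u'\<close>
    is a member of that class.\<close>
  have "tdist W (u k) (u k) = 0" for k
    using tdist_u[of k k] tdist_nonneg[OF u_car u_car, of k k]
      sqms_eq_0_iff[OF sqms cauchy_in_car[OF x(1)] cauchy_in_car[OF x(1)], of k k] by simp
  then have "u \<in> ceq (tensor W) `` {u}"
    using u by (simp add: ceq_def tensor_def)
  moreover define u' where "u' = (SOME y. y \<in> ceq (tensor W) `` {u})"
  ultimately have "u' \<in> ceq (tensor W) `` {u}"
    using someI by metis
  then have u': "cauchy_in (tensor W) u'" and uu': "(\<lambda>i. tdist W (u i) (u' i)) \<longlonglongrightarrow> 0"
    by (auto simp: ceq_def tensor_def)
  have u'_car: "u' k \<in> tcar W" for k using u' by (auto simp: cauchy_in_def tensor_def)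
  have lam_car: "lam d \<in> car W" if "d \<in> tcar W" for d
    using alg that by (auto simp: is_alg_def short_sq_map_def tensor_def)
  have lam_short: "dst W (lam d) (lam d') \<le> tdist W d d'" if "d \<in> tcar W" "d' \<in> tcar W" for d d'
    using alg that by (auto simp: is_alg_def short_sq_map_def tensor_def)
  have cl: "cauchy_in W (lam \<circ> u')"
    unfolding cauchy_in_def
  proof (intro conjI allI impI)
    show "range (lam \<circ> u') \<subseteq> car W" using u'_car lam_car by auto
    fix e :: real assume "0 < e"
    then have "\<exists>M. \<forall>m n. M \<le> m \<longrightarrow> M \<le> n \<longrightarrow> tdist W (u' m) (u' n) < e"
      using u' by (simp add: cauchy_in_def tensor_def)
    then obtain M where M: "\<And>m n. M \<le> m \<Longrightarrow> M \<le> n \<Longrightarrow> tdist W (u' m) (u' n) < e"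
      by blast
    have "dst W ((lam \<circ> u') k) ((lam \<circ> u') l) < e" if "M \<le> k" "M \<le> l" for k l
      using M[OF that] lam_short[OF u'_car u'_car, of k l] by simp
    then show "\<exists>M. \<forall>m n. M \<le> m \<longrightarrow> M \<le> n \<longrightarrow> dst W ((lam \<circ> u') m) ((lam \<circ> u') n) < e" by blast
  qed
  have "ciso W c = ceq (tensor W) `` {u}"
    by (simp add: ciso_def Let_def z_def[symmetric] mv x_def[symmetric] u_def)
  then have \<theta>: "theta W lam c = ceq W `` {lam \<circ> u'}"
    by (simp add: theta_def cmap_def u'_def)
  have flu: "f (lam (u k)) = place m (f (x k))" for k
    unfolding u_def using flam[OF m cauchy_in_car[OF x(1)]] .
  have "(\<lambda>k. place m (f (x k))) \<longlonglongrightarrow> place m (seq_limit x)"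
    unfolding place_def by (intro tendsto_intros cauchy_tendsto x) simp_all
  then have lim_u: "(\<lambda>k. f (lam (u k))) \<longlonglongrightarrow> place m (seq_limit x)"
    by (simp add: flu)
  have "(\<lambda>k. taxi (f (lam (u k))) (f (lam (u' k)))) \<longlonglongrightarrow> 0"
  proof (rule tendsto_sandwich[OF _ _ tendsto_const uu'])
    have "taxi (f (lam (u k))) (f (lam (u' k))) \<le> tdist W (u k) (u' k)" for k
      using lam_short[OF u_car u'_car, of k k] chart_isometric[OF lam_car[OF u_car] lam_car[OF u'_car]]
      by simp
    then show "eventually (\<lambda>k. taxi (f (lam (u k))) (f (lam (u' k))) \<le> tdist W (u k) (u' k)) sequentially"
      by simp
  qed simp
  moreover have "(\<lambda>k. taxi (f (lam (u k))) (f (lam (u' k)))) \<longlonglongrightarrow>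
      taxi (place m (seq_limit x)) (seq_limit (lam \<circ> u'))"
    using tendsto_taxi[OF lim_u cauchy_tendsto[OF cl]] by simp
  ultimately have "taxi (place m (seq_limit x)) (seq_limit (lam \<circ> u')) = 0"
    using LIMSEQ_unique by blast
  then have "cchart (theta W lam c) = place n (cchart v)"
    using cchart_class[OF cl] place_eq x(2) by (simp add: \<theta>)
  moreover have "theta W lam c \<in> ccar W"
    unfolding \<theta> using cl by (rule ceq_class_in_ccar)
  ultimately show "theta W lam (tcls ?V n v) \<in> ccar W"
    "cchart (theta W lam (tcls ?V n v)) = place n (cchart v)"
    by (simp_all add: c_def)
qed

end

section \<open>The unit square as final coalgebra\<close>

definition ternary :: "(nat \<Rightarrow> nat) \<Rightarrow> real" where
  "ternary a = (\<Sum>k. real (a k) / 3 ^ Suc k)"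

text \<open>The expansion with all digits 2, which dominates every other.\<close>

lemma ternary_bound_sums: "(\<lambda>k. 2 / 3 ^ Suc k :: real) sums 1"
  using sums_mult[OF geometric_sums[of "1 / 3 :: real"], of "2 / 3"]
  by (simp add: power_divide divide_simps mult.commute)

lemma ternary_summable:
  assumes "\<And>k. a k \<le> 2"
  shows "summable (\<lambda>k. real (a k) / 3 ^ Suc k)"
  using sums_summable[OF ternary_bound_sums]
proof (rule summable_comparison_test'[of _ 0])
  show "norm (real (a k) / 3 ^ Suc k) \<le> 2 / 3 ^ Suc k" for k
    using assms[of k] by (simp add: divide_right_mono)
qed

lemma ternary_unit_interval:
  assumes "\<And>k. a k \<le> 2"
  shows "ternary a \<in> {0..1}"
proof -
  have "ternary a \<le> (\<Sum>k. 2 / 3 ^ Suc k)"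
    unfolding ternary_def using ternary_summable[OF assms] sums_summable[OF ternary_bound_sums] assms
    by (intro suminf_le divide_right_mono) auto
  then have "ternary a \<le> 1" using sums_unique[OF ternary_bound_sums] by simp
  moreover have "0 \<le> ternary a"
    unfolding ternary_def using ternary_summable[OF assms] by (intro suminf_nonneg) auto
  ultimately show ?thesis by simp
qed

text \<open>Splitting off the first digit is \<open>place\<close> in one coordinate; this makes
  addresses self-similar.\<close>

lemma ternary_unfold:
  assumes "\<And>k. a k \<le> 2"
  shows "ternary a = (real (a 0) + ternary (\<lambda>k. a (Suc k))) / 3"
proof -
  have s: "summable (\<lambda>k. real (a (Suc k)) / 3 ^ Suc k)"
    using assms by (intro ternary_summable)
  have "ternary a = real (a 0) / 3 + (\<Sum>k. real (a (Suc k)) / 3 ^ Suc (Suc k))"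
    unfolding ternary_def
    using suminf_split_head[OF ternary_summable[of a]] assms by simp
  also have "(\<Sum>k. real (a (Suc k)) / 3 ^ Suc (Suc k)) = (\<Sum>k. real (a (Suc k)) / 3 ^ Suc k / 3)"
    by (simp add: mult.commute)
  also have "\<dots> = ternary (\<lambda>k. a (Suc k)) / 3"
    unfolding ternary_def using suminf_divide[OF s, of 3] by simp
  finally show ?thesis by (simp add: add_divide_distrib)
qed

text \<open>A copy of the square algebra, seen through a bijective isometric chart
  \<open>\<Phi>\<close>. Finality is proved in this generality, away from Cauchy sequences.\<close>

locale square_algebra =
  fixes V :: "'v sqms" and \<Phi> :: "'v \<Rightarrow> real \<times> real" and \<theta> :: "((nat \<times> nat) \<times> 'v) set \<Rightarrow> 'v"
  assumes chart_bij: "bij_betw \<Phi> (car V) usq"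
    and chart_dst: "x \<in> car V \<Longrightarrow> y \<in> car V \<Longrightarrow> dst V x y = taxi (\<Phi> x) (\<Phi> y)"
    and sqm_car: "p \<in> M0 \<Longrightarrow> sqm V p \<in> car V"
    and chart_sqm: "p \<in> M0 \<Longrightarrow> \<Phi> (sqm V p) = p"
    and \<theta>_car: "n \<in> Nset \<Longrightarrow> v \<in> car V \<Longrightarrow> \<theta> (tcls V n v) \<in> car V"
    and chart_\<theta>: "n \<in> Nset \<Longrightarrow> v \<in> car V \<Longrightarrow> \<Phi> (\<theta> (tcls V n v)) = place n (\<Phi> v)"
begin

lemma chart_usq: "v \<in> car V \<Longrightarrow> \<Phi> v \<in> usq"
  using chart_bij by (auto simp: bij_betw_def)

lemma chart_eqD: "\<Phi> v = \<Phi> w \<Longrightarrow> v \<in> car V \<Longrightarrow> w \<in> car V \<Longrightarrow> v = w"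
  using chart_bij by (auto simp: bij_betw_def inj_on_def)

lemma sqm_image: "sqm V ` M0 \<subseteq> car V"
  using sqm_car by (rule image_subsetI)

lemma is_sqms: "is_sqms V"
  unfolding is_sqms_def is_metric_on_def
proof (intro conjI)
  show "inj_on (sqm V) M0" using chart_sqm by (rule inj_on_inverseI)
  show "sqm V ` M0 \<subseteq> car V" by (rule sqm_image)
  have *: "dst V (sqm V p) (sqm V q) = taxi p q" if "p \<in> M0" "q \<in> M0" for p q
    using that by (simp add: chart_dst sqm_car chart_sqm)
  then show "\<forall>i\<in>{0, 1}. \<forall>r\<in>{0..1}. \<forall>s\<in>{0..1}. dst V (sqm V (i, r)) (sqm V (i, s)) = \<bar>s - r\<bar> \<and>
      dst V (sqm V (r, i)) (sqm V (s, i)) = \<bar>s - r\<bar>"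
    by (auto simp: taxi_def in_M0_iff)
  show "\<forall>r s t u. (r, s) \<in> M0 \<longrightarrow> (t, u) \<in> M0 \<longrightarrow>
      \<bar>r - t\<bar> + \<bar>s - u\<bar> \<le> dst V (sqm V (r, s)) (sqm V (t, u))"
    by (simp add: * taxi_def)
  show "\<forall>x\<in>car V. \<forall>y\<in>car V. dst V x y \<le> 2"
    by (simp add: chart_dst taxi_le_2 chart_usq)
  show "\<forall>x\<in>car V. \<forall>y\<in>car V. 0 \<le> dst V x y \<and> dst V x y = dst V y x \<and> (dst V x y = 0) = (x = y)"
    using chart_eqD by (auto simp: chart_dst taxi_commute)
  show "\<forall>x\<in>car V. \<forall>y\<in>car V. \<forall>z\<in>car V. dst V x z \<le> dst V x y + dst V y z"
    by (simp add: chart_dst taxi_triangle)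
qed

lemma \<theta>_bij: "bij_betw \<theta> (tcar V) (car V)"
proof (rule bij_betw_imageI)
  show "inj_on \<theta> (tcar V)"
  proof (rule inj_onI)
    fix c c' assume c: "c \<in> tcar V" "c' \<in> tcar V" and eq: "\<theta> c = \<theta> c'"
    obtain n x where nx: "n \<in> Nset" "x \<in> car V" "c = tcls V n x" using c(1) by (rule tcarE)
    obtain m y where my: "m \<in> Nset" "y \<in> car V" "c' = tcls V m y" using c(2) by (rule tcarE)
    have p: "place n (\<Phi> x) = place m (\<Phi> y)" using eq nx my chart_\<theta> by metis
    show "c = c'"
    proof (cases "n = m")
      case True
      then have "\<Phi> x = \<Phi> y" using p by (simp add: place_inject)
      then have "x = y" using nx my by (intro chart_eqD)
      then show ?thesis using nx my True by simp
    next
      case False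
      \<comment> \<open>Equal places in different cells force both points onto cell boundaries,
        where they are glued; injectivity of the chart identifies each point with its boundary
        label.\<close>
      note t = place_eq_imp_teq[OF nx(1) my(1) chart_usq[OF nx(2)] chart_usq[OF my(2)] p False]
      have "sqm V (\<Phi> x) = x" "sqm V (\<Phi> y) = y"
        using t(1,2) nx(2) my(2) sqm_car chart_sqm by (simp_all add: chart_eqD)
      then show ?thesis using t(3)[of V] nx my by (simp add: tcls_eq_iff)
    qed
  qed
  show "\<theta> ` tcar V = car V"
  proof
    show "\<theta> ` tcar V \<subseteq> car V" using \<theta>_car by (auto elim!: tcarE)
    show "car V \<subseteq> \<theta> ` tcar V"
    proof
      fix v assume v: "v \<in> car V"
      obtain n q where n: "n \<in> Nset" "q \<in> usq" "place n q = \<Phi> v"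
        using usq_place[OF chart_usq[OF v]] by blast
      obtain w where w: "w \<in> car V" "\<Phi> w = q"
        using n(2) chart_bij by (metis bij_betw_imp_surj_on imageE)
      have "\<theta> (tcls V n w) = v"
        using n w v \<theta>_car chart_\<theta> by (intro chart_eqD) auto
      then show "v \<in> \<theta> ` tcar V" using tcls_in_tcar[OF n(1) w(1)] by blast
    qed
  qed
qed

abbreviation \<psi> :: "'v \<Rightarrow> ((nat \<times> nat) \<times> 'v) set" where
  "\<psi> \<equiv> inv_into (tcar V) \<theta>"

lemma \<psi>_\<theta>: "c \<in> tcar V \<Longrightarrow> \<psi> (\<theta> c) = c"
  using \<theta>_bij by (simp add: bij_betw_def)

lemma \<theta>_\<psi>: "v \<in> car V \<Longrightarrow> \<theta> (\<psi> v) = v"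
  using \<theta>_bij by (metis bij_betw_imp_surj_on f_inv_into_f)

lemma \<psi>_tcar: "v \<in> car V \<Longrightarrow> \<psi> v \<in> tcar V"
  using \<theta>_bij by (metis bij_betw_imp_surj_on inv_into_into)

lemma coalg: "is_coalg V \<psi>"
  unfolding is_coalg_def short_sq_map_def
proof (intro conjI ballI)
  show "is_sqms V" by (rule is_sqms)
  show "\<psi> ` car V \<subseteq> car (tensor V)" using \<psi>_tcar by (auto simp: tensor_def)
  show "dst (tensor V) (\<psi> v) (\<psi> w) \<le> dst V v w" if vw: "v \<in> car V" "w \<in> car V" for v w
  proof -
    obtain n x where nx: "n \<in> Nset" "x \<in> car V" "\<psi> v = tcls V n x"
      using \<psi>_tcar[OF vw(1)] by (rule tcarE)
    obtain m y where my: "m \<in> Nset" "y \<in> car V" "\<psi> w = tcls V m y"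
      using \<psi>_tcar[OF vw(2)] by (rule tcarE)
    \<comment> \<open>The chart is isometric, so the distortion is 0 and the chain is no longer than
      the distance of \<open>v\<close> and \<open>w\<close>.\<close>
    have "reach V (n, x) (m, y) (taxi (place n (\<Phi> x)) (place m (\<Phi> y)) + 2 * 0 / 3)"
    proof (rule reach_upper_bound[OF is_sqms])
      show "dst V (sqm V p) (sqm V q) \<le> taxi p q" if "p \<in> M0" "q \<in> M0" for p q
        using that by (simp add: chart_dst sqm_car chart_sqm)
      show "\<Phi> ` car V \<subseteq> usq" using chart_usq by (rule image_subsetI)
    qed (use nx my chart_sqm chart_dst in simp_all)
    then have "tdist V (\<psi> v) (\<psi> w) \<le> taxi (place n (\<Phi> x)) (place m (\<Phi> y))"
      using tdist_le[OF is_sqms] nx my by simp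
    also have "\<dots> = dst V v w"
      using chart_\<theta>[OF nx(1,2)] chart_\<theta>[OF my(1,2)] \<theta>_\<psi>[OF vw(1)] \<theta>_\<psi>[OF vw(2)] vw
      by (simp add: chart_dst nx(3) my(3))
    finally show ?thesis by (simp add: tensor_def)
  qed
  show "\<psi> (sqm V p) = sqm (tensor V) p" if p: "p \<in> M0" for p
  proof -
    obtain n q where nq: "n \<in> Nset" "q \<in> usq" "place n q = p"
      using p M0_subset_usq usq_place by (metis subsetD)
    have q: "q \<in> M0" using place_in_M0_D[OF nq(1,2)] nq(3) p by simp
    have "tsq V p = tcls V n (sqm V q)"
      using tsq_place[of n q V] nq p by simp
    moreover have "\<theta> (tcls V n (sqm V q)) = sqm V p"
      using nq p q \<theta>_car chart_\<theta> sqm_car chart_sqm by (intro chart_eqD) auto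
    moreover have "tcls V n (sqm V q) \<in> tcar V"
      using nq(1) sqm_car[OF q] by (rule tcls_in_tcar)
    ultimately show ?thesis using \<psi>_\<theta> by (metis select_convs(3) tensor_def)
  qed
qed

section \<open>The ternary address of a point of a coalgebra\<close>

context
  fixes Y :: "'y sqms" and e :: "'y \<Rightarrow> ((nat \<times> nat) \<times> 'y) set"
  assumes Y_coalg: "is_coalg Y e"
begin

text \<open>One observation of \<open>y\<close>: the first component is the next pair of digits, the
  second the point to observe next. On glued points the choice is arbitrary, as for numbers with two
  expansions.\<close>

definition rep :: "'y \<Rightarrow> (nat \<times> nat) \<times> 'y" where
  "rep y = (SOME z. z \<in> e y)"

lemma Y_sqms: "is_sqms Y"
  using Y_coalg by (simp add: is_coalg_def)

lemma e_tcar: "y \<in> car Y \<Longrightarrow> e y \<in> tcar Y"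
  using Y_coalg by (auto simp: is_coalg_def short_sq_map_def tensor_def)

lemma rep_in: "y \<in> car Y \<Longrightarrow> rep y \<in> e y"
  unfolding rep_def using e_tcar by (rule tcar_some_in)

lemma rep_car:
  assumes "y \<in> car Y"
  shows "fst (rep y) \<in> Nset" "snd (rep y) \<in> car Y"
proof -
  have "sqm Y ` M0 \<subseteq> car Y" using sqms_sqm_in[OF Y_sqms] by (rule image_subsetI)
  then show "fst (rep y) \<in> Nset" "snd (rep y) \<in> car Y"
    using tcar_memD(1,2)[OF e_tcar[OF assms] rep_in[OF assms]] by auto
qed

definition digit :: "'y \<Rightarrow> nat \<Rightarrow> nat \<times> nat" where
  "digit y k = fst (rep (((\<lambda>y. snd (rep y)) ^^ k) y))"

text \<open>A morphism \<open>h\<close> to \<open>V\<close> satisfies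
  \<open>\<Phi> (h y) = place n (\<Phi> (h y'))\<close> for \<open>(n, y') = rep y\<close>;
  unfolding this forever leaves this point as the only possible value.\<close>

definition address :: "'y \<Rightarrow> real \<times> real" where
  "address y = (ternary (\<lambda>k. fst (digit y k)), ternary (\<lambda>k. snd (digit y k)))"

lemma digit_le:
  assumes "y \<in> car Y"
  shows "fst (digit y k) \<le> 2" "snd (digit y k) \<le> 2"
proof -
  have "((\<lambda>y. snd (rep y)) ^^ k) y \<in> car Y"
    using assms by (induction k) (auto intro: rep_car)
  then have "digit y k \<in> Nset" unfolding digit_def by (rule rep_car)
  then show "fst (digit y k) \<le> 2" "snd (digit y k) \<le> 2"
    using in_Nset_iff[of "fst (digit y k)" "snd (digit y k)"] by simp_all
qed

lemma address_usq: "y \<in> car Y \<Longrightarrow> address y \<in> usq"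
  unfolding address_def using digit_le by (intro SigmaI ternary_unit_interval)

lemma address_unfold:
  assumes "y \<in> car Y"
  shows "address y = place (fst (rep y)) (address (snd (rep y)))"
proof -
  have "digit y (Suc k) = digit (snd (rep y)) k" for k
    by (simp add: digit_def funpow_Suc_right del: funpow.simps)
  moreover have "digit y 0 = fst (rep y)" by (simp add: digit_def)
  ultimately show ?thesis
    using ternary_unfold[of "\<lambda>k. fst (digit y k)"] ternary_unfold[of "\<lambda>k. snd (digit y k)"]
      digit_le[OF assms]
    by (simp add: address_def place_def)
qed

text \<open>\<open>e\<close> respects the boundary, so \<open>e (sqm Y p)\<close> contains a
  boundary point. By \<open>teq_cases\<close> a gluing class with one such point has no others, so
  the chosen representative is a boundary point too.\<close>

lemma rep_sqm:
  assumes "p \<in> M0"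
  obtains q where "q \<in> M0" "snd (rep (sqm Y p)) = sqm Y q" "place (fst (rep (sqm Y p))) q = p"
proof -
  obtain n q where nq: "n \<in> Nset" "q \<in> usq" "place n q = p"
    using assms M0_subset_usq usq_place by (metis subsetD)
  have q: "q \<in> M0" using place_in_M0_D[OF nq(1,2)] nq(3) assms by simp
  have "e (sqm Y p) = tcls Y n (sqm Y q)"
    using Y_coalg assms tsq_place[of n q Y] nq
    by (simp add: is_coalg_def short_sq_map_def tensor_def)
  then have t: "((n, sqm Y q), rep (sqm Y p)) \<in> teq Y"
    using rep_in[OF sqms_sqm_in[OF Y_sqms assms]] by (simp add: in_tcls_iff)
  obtain r where r: "r \<in> M0" "snd (rep (sqm Y p)) = sqm Y r"
    using t
  proof (cases rule: teq_cases)
    case 1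
    then show thesis using that[OF q] by (metis snd_conv)
  qed (rule that)
  \<comment> \<open>\<open>sqm Y\<close> is injective on \<open>M0\<close>, so its inverse can serve
    as \<open>h\<close> in \<open>teq_place\<close>.\<close>
  have inv: "inv_into M0 (sqm Y) (sqm Y s) = s" if "s \<in> M0" for s
    using sqms_inj[OF Y_sqms] that by (rule inv_into_f_f)
  have "place n q = place (fst (rep (sqm Y p))) r"
    using teq_place[OF t inv] r q by (simp add: inv)
  then show thesis using that r nq by metis
qed

text \<open>Observing \<open>sqm Y p\<close> yields a cell containing \<open>p\<close> and again a
  boundary point, so the discrepancy, at most 2 at the start, is divided by 3 at each step.\<close>

lemma address_sqm:
  assumes "p \<in> M0"
  shows "address (sqm Y p) = p"
proof -
  have bound: "taxi (address (sqm Y p)) p \<le> 0 + 2 * (1 / 3) ^ k" if "p \<in> M0" for k p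
    using that
  proof (induction k arbitrary: p)
    case 0
    then have "address (sqm Y p) \<in> usq" "p \<in> usq"
      using address_usq sqms_sqm_in[OF Y_sqms] M0_subset_usq by blast+
    then show ?case using taxi_le_2 by simp
  next
    case (Suc k)
    obtain q where q: "q \<in> M0" "snd (rep (sqm Y p)) = sqm Y q" "place (fst (rep (sqm Y p))) q = p"
      using rep_sqm[OF Suc.prems] by blast
    have "address (sqm Y p) = place (fst (rep (sqm Y p))) (address (sqm Y q))"
      using address_unfold[OF sqms_sqm_in[OF Y_sqms Suc.prems]] q(2) by simp
    then have "taxi (address (sqm Y p)) p = taxi (address (sqm Y q)) q / 3"
      using q(3) taxi_place by metis
    then show ?case using Suc.IH[OF q(1)] by simp
  qed
  have "taxi (address (sqm Y p)) p \<le> 0"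
    by (rule le_if_geometric_le[OF _ _ bound[OF assms]]) simp_all
  then show ?thesis using taxi_nonneg[of "address (sqm Y p)" p] taxi_eq_0_iff by (metis order_antisym)
qed

text \<open>The defect is additive, so it starts at 2 for any map into the square. After unfolding
  both addresses by one digit, \<open>tdist_lower_bound\<close> multiplies it by 2/3, and shortness
  of \<open>e\<close> returns to \<open>dst Y\<close>.\<close>

lemma address_short:
  assumes "x \<in> car Y" "y \<in> car Y"
  shows "taxi (address x) (address y) \<le> dst Y x y"
proof -
  have bound: "taxi (address x) (address y) \<le> dst Y x y + 2 * (2 / 3) ^ k"
    if "x \<in> car Y" "y \<in> car Y" for k x y
    using that
  proof (induction k arbitrary: x y)
    case 0
    then show ?case
      using taxi_le_2[OF address_usq address_usq, of x y] sqms_nonneg[OF Y_sqms, of x y] by simp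
  next
    case (Suc k)
    have "taxi (address x) (address y) \<le> tdist Y (e x) (e y) + 2 * (2 * (2 / 3) ^ k) / 3"
      unfolding address_unfold[OF Suc.prems(1)] address_unfold[OF Suc.prems(2)]
      using Suc.prems by (intro tdist_lower_bound[OF Y_sqms image_subsetI[OF address_usq] address_sqm]
          Suc.IH e_tcar rep_in) simp_all
    moreover have "tdist Y (e x) (e y) \<le> dst Y x y"
      using Y_coalg Suc.prems by (simp add: is_coalg_def short_sq_map_def tensor_def)
    ultimately show ?case by simp
  qed
  show ?thesis
    by (rule le_if_geometric_le[OF _ _ bound[OF assms]]) simp_all
qed

lemma coalg_mor_exists: "coalg_mor Y e V \<psi> (\<lambda>y. inv_into (car V) \<Phi> (address y))"
proof -
  define h where "h y = inv_into (car V) \<Phi> (address y)" for y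
  have \<Phi>h: "\<Phi> (h y) = address y" and h_car: "h y \<in> car V" if "y \<in> car Y" for y
    using address_usq[OF that] chart_bij unfolding h_def
    by (metis bij_betw_imp_surj_on f_inv_into_f, metis bij_betw_imp_surj_on inv_into_into)
  have "\<psi> (h y) = tmap V h (e y)" if y: "y \<in> car Y" for y
  proof -
    note r = rep_car[OF y]
    \<comment> \<open>The coalgebra equation is checked after applying \<open>\<theta>\<close>,
      where it becomes \<open>address_unfold\<close> in the chart.\<close>
    have "\<theta> (tcls V (fst (rep y)) (h (snd (rep y)))) = h y"
      using r y h_car \<Phi>h \<theta>_car chart_\<theta> address_unfold[OF y] by (intro chart_eqD) auto
    then show ?thesis
      using \<psi>_\<theta>[OF tcls_in_tcar[OF r(1) h_car[OF r(2)]]] by (simp add: tmap_def rep_def Let_def)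
  qed
  moreover have "short_sq_map Y V h"
    unfolding short_sq_map_def
  proof (intro conjI ballI)
    show "h ` car Y \<subseteq> car V" using h_car by (rule image_subsetI)
    show "dst V (h x) (h y) \<le> dst Y x y" if "x \<in> car Y" "y \<in> car Y" for x y
      using that address_short \<Phi>h h_car by (simp add: chart_dst)
    show "h (sqm Y p) = sqm V p" if p: "p \<in> M0" for p
    proof -
      have s: "sqm Y p \<in> car Y" using sqms_sqm_in[OF Y_sqms p] .
      show ?thesis
        using \<Phi>h[OF s] h_car[OF s] address_sqm[OF p] chart_sqm[OF p] sqm_car[OF p]
        by (intro chart_eqD) simp_all
    qed
  qed
  ultimately show ?thesis
    by (simp add: coalg_mor_def h_def[abs_def])
qed

text \<open>Both morphisms take their digit from the same \<open>rep y\<close>, so their values lie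
  in one cell, at a third of the distance found at the next point.\<close>

lemma coalg_mor_unique:
  assumes h: "coalg_mor Y e V \<psi> h" and h': "coalg_mor Y e V \<psi> h'" and y: "y \<in> car Y"
  shows "h' y = h y"
proof -
  have car: "g y \<in> car V" if "coalg_mor Y e V \<psi> g" "y \<in> car Y" for g y
    using that by (auto simp: coalg_mor_def short_sq_map_def)
  have unfold: "\<Phi> (g y) = place (fst (rep y)) (\<Phi> (g (snd (rep y))))"
    if g: "coalg_mor Y e V \<psi> g" and y: "y \<in> car Y" for g y
  proof -
    have "\<psi> (g y) = tcls V (fst (rep y)) (g (snd (rep y)))"
      using g y by (simp add: coalg_mor_def tmap_def rep_def Let_def)
    then have "g y = \<theta> (tcls V (fst (rep y)) (g (snd (rep y))))"
      using \<theta>_\<psi>[OF car[OF g y]] by simp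
    then show ?thesis
      using chart_\<theta>[OF rep_car(1)[OF y] car[OF g rep_car(2)[OF y]]] by simp
  qed
  have bound: "taxi (\<Phi> (h' y)) (\<Phi> (h y)) \<le> 0 + 2 * (1 / 3) ^ k" if "y \<in> car Y" for k y
    using that
  proof (induction k arbitrary: y)
    case 0
    then show ?case using taxi_le_2[OF chart_usq[OF car[OF h']] chart_usq[OF car[OF h]]] by simp
  next
    case (Suc k)
    then show ?case
      using Suc.IH[OF rep_car(2)[OF Suc.prems]]
      by (simp add: unfold[OF h Suc.prems] unfold[OF h' Suc.prems] taxi_place)
  qed
  have "taxi (\<Phi> (h' y)) (\<Phi> (h y)) \<le> 0"
    by (rule le_if_geometric_le[OF _ _ bound[OF y]]) simp_all
  then have "\<Phi> (h' y) = \<Phi> (h y)"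
    using taxi_nonneg[of "\<Phi> (h' y)" "\<Phi> (h y)"] taxi_eq_0_iff by (metis order_antisym)
  then show ?thesis using car[OF h' y] car[OF h y] by (rule chart_eqD)
qed

end

end

theorem mainTheorem8:
  fixes W :: "'w sqms" and lam :: "((nat \<times> nat) \<times> 'w) set \<Rightarrow> 'w"
  assumes "initial_alg W lam"
  shows "bij_betw (theta W lam) (car (tensor (completion W))) (car (completion W)) \<and>
    is_coalg (completion W) (inv_into (car (tensor (completion W))) (theta W lam)) \<and>
    (\<forall>(Y :: 'y sqms) e. is_coalg Y e \<longrightarrow>
       (\<exists>h. coalg_mor Y e (completion W) (inv_into (car (tensor (completion W))) (theta W lam)) h \<and>
            (\<forall>h'. coalg_mor Y e (completion W) (inv_into (car (tensor (completion W))) (theta W lam)) h'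
                  \<longrightarrow> (\<forall>y\<in>car Y. h' y = h y))))"
proof -
  have alg: "is_alg W lam" using assms by (simp add: initial_alg_def)
  have W: "is_sqms W" using alg by (simp add: is_alg_def)
  obtain f :: "'w \<Rightarrow> real \<times> real" where f: "f ` car W \<subseteq> usq"
    and short: "\<And>x y. x \<in> car W \<Longrightarrow> y \<in> car W \<Longrightarrow> taxi (f x) (f y) \<le> dst W x y"
    and fS: "\<And>p. p \<in> M0 \<Longrightarrow> f (sqm W p) = p"
    and flam: "\<And>n x. n \<in> Nset \<Longrightarrow> x \<in> car W \<Longrightarrow> f (lam (tcls W n x)) = place n (f x)"
    using initial_alg_to_usq[OF assms] by blast
  interpret chart: square_chart W f
  proof
    show "is_sqms W" by (rule W)
    show "f x \<in> usq" if "x \<in> car W" for x using f that by blast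
    show "dst W x y = taxi (f x) (f y)" if "x \<in> car W" "y \<in> car W" for x y
      using short[OF that] initial_alg_isometric[OF assms f fS flam that] by (rule order_antisym[rotated])
    show "\<exists>w\<in>car W. taxi (f w) q \<le> 2 * (1 / 3) ^ k" if "q \<in> usq" for q k
      using alg_dense[OF alg fS f flam that] .
  qed (rule fS)
  \<comment> \<open>The completion is the square: \<open>cchart\<close> is the chart and
    \<open>theta\<close> acts as \<open>place\<close>.\<close>
  interpret V: square_algebra "completion W" chart.cchart "theta W lam"
    by unfold_locales
      (simp_all add: completion_def chart.cchart_bij chart.cchart_isometric chart.csq_chart
        chart.theta_chart[OF alg flam, unfolded completion_def])
  have tensor: "car (tensor (completion W)) = tcar (completion W)"
    by (simp add: tensor_def)
  show ?thesis
    unfolding tensor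
  proof (intro conjI allI impI)
    fix Y :: "'y sqms" and e assume Y: "is_coalg Y e"
    show "\<exists>h. coalg_mor Y e (completion W) V.\<psi> h \<and>
        (\<forall>h'. coalg_mor Y e (completion W) V.\<psi> h' \<longrightarrow> (\<forall>y\<in>car Y. h' y = h y))"
      using V.coalg_mor_exists[OF Y] V.coalg_mor_unique[OF Y V.coalg_mor_exists[OF Y]] by blast
  qed (rule V.\<theta>_bij V.coalg)+
qed

end
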